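(* Let $\varphi,\psi\in L^2(\mathbb{R})$ with $\|\varphi\|_2,\|\psi\|_2\geq1$. Let $\{f_n\}_{n=1}^{\infty}$ be a Riesz basis for $L^2(\mathbb{R})$ with orthonormalizer $U$ that is near enough to an isometry, in the sense that $$(1+\beta)^{-1}\leq\|U\|^2\leq\|U^{-1}\|^2\leq1+\beta$$ with $\beta$ small enough. Then there exists a constant $N=N(\varphi,\psi,\beta)$, depending only on $\varphi$, $\psi$ and $\beta$, such that the number of terms of the basis that satisfy $$|f_n(x)|\leq|\varphi(x)|\quad\text{and}\quad|\widehat{f}_n(\xi)|\leq|\psi(\xi)|$$ for almost all $x,\xi\in\mathbb{R}$ is bounded by $N$. Moreover, a bound on $N$ can be given in terms of spherical codes.
   Context: A sequence $\{f_n\}_{n=1}^\infty$ is a Riesz basis for $L^2(\mathbb{R})$ if there is an isomorphism (bounded invertible linear operator) $U:L^2(\mathbb{R})\to L^2(\mathbb{R})$, called its orthonormalizer, such that $\{Uf_n\}_{n=1}^\infty$ is an orthonormal basis for $L^2(\mathbb{R})$. Norms of $U$ and $U^{-1}$ are operator norms. The Fourier transform is $\widehat{f}(\xi)=\int f(t)e^{-2i\pi t\xi}\,dt$ for $f\in L^1(\mathbb{R})$, extended to $L^2(\mathbb{R})$ as usual. Spherical codes: let $\mathbb{K}=\mathbb{R}$ or $\mathbb{C}$ and $d\ge1$, and let $\mathbb{S}_d$ be the unit sphere of $\mathbb{K}^d$ with the standard scalar product. For $A\subset\{z\in\mathbb{K}:|z|\le1\}$, a spherical $A$-code is a finite subset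 $V\subset\mathbb{S}_d$ such that $\langle u,v\rangle\in A$ whenever $u,v\in V$, $u\neq v$. A bound "in terms of spherical codes" means a bound by the maximal cardinality of a spherical $A$-code, with $A=[-\alpha,\alpha]$ if $\mathbb{K}=\mathbb{R}$ or $A=\{z\in\mathbb{C}:|z|\le\alpha\}$ if $\mathbb{K}=\mathbb{C}$, for suitable $\alpha$ and $d$. *)

theory Defs
  imports
    "HOL-Analysis.Analysis"
    "HOL-Library.Extended_Nat"
    "Jordan_Normal_Form.Matrix"
begin

section \<open>The complex Hilbert space of square-integrable functions on the real line\<close>

definition square_integrable :: "(real \<Rightarrow> complex) \<Rightarrow> bool" where
  "square_integrable f \<longleftrightarrow>
     f \<in> borel_measurable lborel \<and> integrable lborel (\<lambda>x. (cmod (f x))\<^sup>2)"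

definition L2_rel :: "(real \<Rightarrow> complex) \<Rightarrow> (real \<Rightarrow> complex) \<Rightarrow> bool" where
  "L2_rel f g \<longleftrightarrow> square_integrable f \<and> square_integrable g \<and> (AE x in lborel. f x = g x)"

lemma square_integrable_zero: "square_integrable (\<lambda>x. 0)"
  by (simp add: square_integrable_def)

lemma square_integrable_measurable [measurable_dest]:
  "square_integrable f \<Longrightarrow> f \<in> borel_measurable lborel"
  by (simp add: square_integrable_def)

lemma square_integrable_scale:
  assumes "square_integrable f"
  shows "square_integrable (\<lambda>x. c * f x)"
  using assms by (auto simp: square_integrable_def norm_mult power_mult_distrib)

lemma square_integrable_add:
  assumes f: "square_integrable f" and g: "square_integrable g"
  shows "square_integrable (\<lambda>x. f x + g x)"
proof -
  have [measurable]: "f \<in> borel_measurable lborel" "g \<in> borel_measurable lborel"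
    using f g by (auto simp: square_integrable_def)
  have "integrable lborel (\<lambda>x. (cmod (f x + g x))\<^sup>2)"
  proof (rule Bochner_Integration.integrable_bound)
    show "integrable lborel (\<lambda>x. 2 * (cmod (f x))\<^sup>2 + 2 * (cmod (g x))\<^sup>2)"
      using f g by (auto simp: square_integrable_def)
    show "AE x in lborel. norm ((cmod (f x + g x))\<^sup>2)
            \<le> norm (2 * (cmod (f x))\<^sup>2 + 2 * (cmod (g x))\<^sup>2)"
    proof (rule AE_I2)
      fix x
      have "(cmod (f x + g x))\<^sup>2 \<le> (cmod (f x) + cmod (g x))\<^sup>2"
        by (intro power_mono norm_triangle_ineq) auto
      also have "\<dots> \<le> 2 * (cmod (f x))\<^sup>2 + 2 * (cmod (g x))\<^sup>2"
        using sum_squares_bound[of "cmod (f x)" "cmod (g x)"]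
        by (simp add: power2_sum)
      finally show "norm ((cmod (f x + g x))\<^sup>2)
            \<le> norm (2 * (cmod (f x))\<^sup>2 + 2 * (cmod (g x))\<^sup>2)"
        by simp
    qed
  qed measurable
  then show ?thesis by (simp add: square_integrable_def)
qed

lemma square_integrable_product:
  assumes f: "square_integrable f" and g: "square_integrable g"
  shows "integrable lborel (\<lambda>x. f x * cnj (g x))"
proof (rule Bochner_Integration.integrable_bound)
  have [measurable]: "f \<in> borel_measurable lborel" "g \<in> borel_measurable lborel"
    using f g by (auto simp: square_integrable_def)
  show "integrable lborel (\<lambda>x. (cmod (f x))\<^sup>2 + (cmod (g x))\<^sup>2)"
    using f g by (auto simp: square_integrable_def)
  have [measurable]: "(\<lambda>x. cnj (g x)) \<in> borel_measurable lborel"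
    by (rule borel_measurable_continuous_on[where f = cnj]) (auto intro: continuous_intros)
  show "(\<lambda>x. f x * cnj (g x)) \<in> borel_measurable lborel"
    by measurable
  show "AE x in lborel. norm (f x * cnj (g x)) \<le> norm ((cmod (f x))\<^sup>2 + (cmod (g x))\<^sup>2)"
  proof (rule AE_I2)
    fix x
    have "0 \<le> cmod (f x) * cmod (g x)" by simp
    moreover have "2 * (cmod (f x) * cmod (g x)) \<le> (cmod (f x))\<^sup>2 + (cmod (g x))\<^sup>2"
      using sum_squares_bound[of "cmod (f x)" "cmod (g x)"] by simp
    ultimately show "norm (f x * cnj (g x)) \<le> norm ((cmod (f x))\<^sup>2 + (cmod (g x))\<^sup>2)"
      unfolding norm_mult complex_mod_cnj real_norm_def by linarith
  qed
qed

quotient_type L2 = "real \<Rightarrow> complex" / partial: L2_rel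
proof (rule part_equivpI)
  show "\<exists>f. L2_rel f f"
    by (rule exI[of _ "\<lambda>x. 0"]) (simp add: L2_rel_def square_integrable_zero)
  show "symp L2_rel"
    by (auto simp: symp_def L2_rel_def)
  show "transp L2_rel"
    by (auto simp: transp_def L2_rel_def)
qed

instantiation L2 :: real_vector
begin

lift_definition zero_L2 :: L2 is "\<lambda>x. 0"
  by (simp add: L2_rel_def square_integrable_zero)

lift_definition plus_L2 :: "L2 \<Rightarrow> L2 \<Rightarrow> L2" is "\<lambda>f g x. f x + g x"
  by (auto simp: L2_rel_def square_integrable_add)

lift_definition uminus_L2 :: "L2 \<Rightarrow> L2" is "\<lambda>f x. - f x"
  using square_integrable_scale[where c = "-1"] by (auto simp: L2_rel_def)

definition minus_L2 :: "L2 \<Rightarrow> L2 \<Rightarrow> L2" where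
  "minus_L2 f g = f + (- g)"

lift_definition scaleR_L2 :: "real \<Rightarrow> L2 \<Rightarrow> L2" is "\<lambda>r f x. of_real r * f x"
  by (auto simp: L2_rel_def square_integrable_scale)

instance
proof
  fix f g h :: L2 and r s :: real
  show "f + g + h = f + (g + h)"
    by transfer (auto simp: L2_rel_def square_integrable_add algebra_simps)
  show "f + g = g + f"
    by transfer (auto simp: L2_rel_def square_integrable_add algebra_simps)
  show "0 + f = f"
    by transfer (auto simp: L2_rel_def)
  show "- f + f = 0"
    by transfer (auto simp: L2_rel_def square_integrable_zero)
  show "f - g = f + - g"
    by (simp add: minus_L2_def)
  show "r *\<^sub>R (f + g) = r *\<^sub>R f + r *\<^sub>R g"
    by transfer
      (auto simp: L2_rel_def square_integrable_add square_integrable_scale distrib_left)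
  show "(r + s) *\<^sub>R f = r *\<^sub>R f + s *\<^sub>R f"
    using square_integrable_scale[where c = "of_real r + of_real s"]
    by transfer
      (auto simp: L2_rel_def square_integrable_add square_integrable_scale distrib_right)
  show "r *\<^sub>R s *\<^sub>R f = (r * s) *\<^sub>R f"
    using square_integrable_scale[where c = "of_real r * of_real s"]
    by transfer (auto simp: L2_rel_def square_integrable_scale mult.assoc)
  show "1 *\<^sub>R f = f"
    by transfer (auto simp: L2_rel_def)
qed

end

lift_definition scaleC_L2 :: "complex \<Rightarrow> L2 \<Rightarrow> L2" (infixr \<open>*\<^sub>C\<close> 75)
  is "\<lambda>c f x. c * f x"
  by (auto simp: L2_rel_def square_integrable_scale)

lift_definition cinner_L2 :: "L2 \<Rightarrow> L2 \<Rightarrow> complex"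
  is "\<lambda>f g. LINT x|lborel. f x * cnj (g x)"
proof -
  fix f f' g g' :: "real \<Rightarrow> complex"
  assume "L2_rel f f'" and "L2_rel g g'"
  then have "integrable lborel (\<lambda>x. f x * cnj (g x))" "integrable lborel (\<lambda>x. f' x * cnj (g' x))"
    and "AE x in lborel. f x * cnj (g x) = f' x * cnj (g' x)"
    by (auto simp: L2_rel_def square_integrable_product)
  then show "(LINT x|lborel. f x * cnj (g x)) = (LINT x|lborel. f' x * cnj (g' x))"
    by (intro integral_cong_AE) (auto dest: borel_measurable_integrable)
qed

instantiation L2 :: real_inner
begin

definition inner_L2 :: "L2 \<Rightarrow> L2 \<Rightarrow> real" where
  "inner_L2 f g = Re (cinner_L2 f g)"

definition norm_L2 :: "L2 \<Rightarrow> real" where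
  "norm_L2 f = sqrt (inner f f)"

definition dist_L2 :: "L2 \<Rightarrow> L2 \<Rightarrow> real" where
  "dist_L2 f g = norm (f - g)"

definition sgn_L2 :: "L2 \<Rightarrow> L2" where
  "sgn_L2 f = inverse (norm f) *\<^sub>R f"

definition uniformity_L2 :: "(L2 \<times> L2) filter" where
  "uniformity_L2 = (INF e\<in>{0<..}. principal {(f, g). dist f g < e})"

definition open_L2 :: "L2 set \<Rightarrow> bool" where
  "open_L2 S = (\<forall>f\<in>S. \<forall>\<^sub>F (f', g) in uniformity. f' = f \<longrightarrow> g \<in> S)"

instance
proof
  fix f g h :: L2 and r :: real
  have int: "integrable lborel (\<lambda>x. u x * cnj (v x))"
    if "L2_rel u u" "L2_rel v v" for u v :: "real \<Rightarrow> complex"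
    using that by (auto simp: L2_rel_def square_integrable_product)
  have self: "(LINT x|lborel. u x * cnj (u x)) = of_real (LINT x|lborel. (cmod (u x))\<^sup>2)"
    for u :: "real \<Rightarrow> complex"
    unfolding complex_norm_square[symmetric] by (rule integral_complex_of_real)
  show "dist f g = norm (f - g)" by (rule dist_L2_def)
  show "sgn f = f /\<^sub>R norm f" by (rule sgn_L2_def)
  show "uniformity = (INF e\<in>{0<..}. principal {(f :: L2, g). dist f g < e})"
    by (rule uniformity_L2_def)
  show "open S = (\<forall>f\<in>S. \<forall>\<^sub>F (f', g) in uniformity. f' = f \<longrightarrow> g \<in> S)" for S :: "L2 set"
    by (rule open_L2_def)
  show "norm f = sqrt (inner f f)" by (rule norm_L2_def)
  show "inner f g = inner g f"
    unfolding inner_L2_def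
  proof transfer
    fix u v :: "real \<Rightarrow> complex"
    have "(LINT x|lborel. v x * cnj (u x)) = (LINT x|lborel. cnj (u x * cnj (v x)))"
      by (simp add: mult.commute)
    also have "\<dots> = cnj (LINT x|lborel. u x * cnj (v x))"
      by (rule Bochner_Integration.integral_cnj)
    finally show "Re (LINT x|lborel. u x * cnj (v x)) = Re (LINT x|lborel. v x * cnj (u x))"
      by simp
  qed
  show "inner (f + g) h = inner f h + inner g h"
    unfolding inner_L2_def by transfer (simp add: distrib_right int)
  show "inner (r *\<^sub>R f) g = r * inner f g"
    unfolding inner_L2_def by transfer (simp add: mult.assoc)
  show "0 \<le> inner f f"
    unfolding inner_L2_def by transfer (simp add: self)
  show "inner f f = 0 \<longleftrightarrow> f = 0"
    unfolding inner_L2_def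
  proof transfer
    fix u :: "real \<Rightarrow> complex"
    assume u: "L2_rel u u"
    then have "integrable lborel (\<lambda>x. (cmod (u x))\<^sup>2)"
      by (simp add: L2_rel_def square_integrable_def)
    then have "(LINT x|lborel. (cmod (u x))\<^sup>2) = 0 \<longleftrightarrow> (AE x in lborel. (cmod (u x))\<^sup>2 = 0)"
      by (rule integral_nonneg_eq_0_iff_AE) simp
    then show "Re (LINT x|lborel. u x * cnj (u x)) = 0 \<longleftrightarrow> L2_rel u (\<lambda>x. 0)"
      using u by (simp add: self L2_rel_def square_integrable_zero)
  qed
qed

end

text \<open>
  \<open>L2_fun f\<close> is some representative of the class \<open>f\<close>; only almost-everywhere statements
  about it are meaningful. \<open>L2_of g\<close> is the class of a square-integrable function \<open>g\<close>.
\<close>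

abbreviation L2_fun :: "L2 \<Rightarrow> real \<Rightarrow> complex" where
  "L2_fun \<equiv> rep_L2"

abbreviation L2_of :: "(real \<Rightarrow> complex) \<Rightarrow> L2" where
  "L2_of \<equiv> abs_L2"


section \<open>The Fourier transform\<close>

definition fourier_integral :: "(real \<Rightarrow> complex) \<Rightarrow> real \<Rightarrow> complex" where
  "fourier_integral f \<xi> =
     (LINT t|lborel. f t * exp (- 2 * \<i> * complex_of_real pi * of_real t * of_real \<xi>))"

text \<open>
  The extension to \<open>L2\<close> by density and continuity: \<open>g\<close> is the Fourier transform of \<open>f\<close> if
  some sequence of functions that are both integrable and square-integrable converges to \<open>f\<close>
  in \<open>L2\<close> while the sequence of their Fourier integrals converges to \<open>g\<close> in \<open>L2\<close>.
  By Plancherel's theorem every \<open>f\<close> has exactly one such \<open>g\<close>, and the square-integrability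
  required of the Fourier integrals is automatic.
\<close>

definition has_fourier_transform :: "L2 \<Rightarrow> L2 \<Rightarrow> bool" where
  "has_fourier_transform f g \<longleftrightarrow>
     (\<exists>h :: nat \<Rightarrow> real \<Rightarrow> complex.
        (\<forall>k. integrable lborel (h k) \<and> square_integrable (h k)
             \<and> square_integrable (fourier_integral (h k)))
        \<and> (\<lambda>k. L2_of (h k)) \<longlonglongrightarrow> f
        \<and> (\<lambda>k. L2_of (fourier_integral (h k))) \<longlonglongrightarrow> g)"


section \<open>Riesz bases\<close>

definition orthonormal_basis :: "(nat \<Rightarrow> L2) \<Rightarrow> bool" where
  "orthonormal_basis e \<longleftrightarrow>
     (\<forall>m n. cinner_L2 (e m) (e n) = (if m = n then 1 else 0))
     \<and> (\<forall>g. (\<lambda>n. cinner_L2 g (e n) *\<^sub>C e n) sums g)"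

definition L2_isomorphism :: "(L2 \<Rightarrow> L2) \<Rightarrow> bool" where
  "L2_isomorphism U \<longleftrightarrow>
     bounded_linear U \<and> (\<forall>c f. U (c *\<^sub>C f) = c *\<^sub>C U f) \<and> bij U \<and> bounded_linear (inv_into UNIV U)"

definition orthonormalizer :: "(L2 \<Rightarrow> L2) \<Rightarrow> (nat \<Rightarrow> L2) \<Rightarrow> bool" where
  "orthonormalizer U f \<longleftrightarrow> L2_isomorphism U \<and> orthonormal_basis (\<lambda>n. U (f n))"

definition riesz_basis :: "(nat \<Rightarrow> L2) \<Rightarrow> bool" where
  "riesz_basis f \<longleftrightarrow> (\<exists>U. orthonormalizer U f)"


section \<open>Spherical codes\<close>

definition spherical_code ::
  "'k :: conjugatable_ordered_field set \<Rightarrow> nat \<Rightarrow> 'k vec set \<Rightarrow> bool" where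
  "spherical_code A d V \<longleftrightarrow>
     finite V \<and> V \<subseteq> carrier_vec d \<and> (\<forall>v\<in>V. v \<bullet>c v = 1)
     \<and> (\<forall>u\<in>V. \<forall>v\<in>V. u \<noteq> v \<longrightarrow> u \<bullet>c v \<in> A)"

text \<open>The value is \<open>\<infinity>\<close> if there are arbitrarily large codes.\<close>

definition max_spherical_code :: "'k :: conjugatable_ordered_field set \<Rightarrow> nat \<Rightarrow> enat" where
  "max_spherical_code A d = (SUP V \<in> {V. spherical_code A d V}. enat (card V))"

end

(*
  This is a time-frequency concentration argument in the style of Landau, Pollak and Slepian.
  Choose R and T such that phi has little mass outside E = {|x| <= R, |phi| <= R} and psi little
  mass outside [-T, T]. By Plancherel every f_n dominated by phi and psi satisfies
  int_{-T}^{T} |F(1_E f_n)|^2 >= 1/4. But F(1_E f_n)(xi) is the inner product of f_n with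
  1_E e^{2 pi i x xi}, so Bessel's inequality for the Riesz basis bounds the sum over n of
  |F(1_E f_n)(xi)|^2 by ||U^{-1}||^2 |E| <= 4 R for each xi. Integrating over [-T, T] gives at
  most 32 R T such n; every beta <= 1 is admissible. An orthonormal basis of K^N is a spherical
  code with alpha = 0 and N elements.

  Plancherel's identity is needed only for bounded u: the Gaussian means of |F u|^2 are Gaussian
  means of the autocorrelation of u, which is continuous at 0.
*)
theory Submission
  imports Defs "HOL-Probability.Characteristic_Functions" "HOL-Real_Asymp.Real_Asymp"
begin

section \<open>Fourier integrals of integrable functions\<close>

lemma borel_measurable_cnj [measurable (raw)]:
  "f \<in> borel_measurable M \<Longrightarrow> (\<lambda>x. cnj (f x)) \<in> borel_measurable M"
  by (rule borel_measurable_continuous_on[where f = cnj]) (auto intro: continuous_intros)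

lemma norm_exp_character:
  "cmod (exp (- 2 * \<i> * complex_of_real pi * of_real t * of_real \<xi>)) = 1"
  by (simp add: norm_exp_eq_Re)

lemma integrable_character:
  assumes "integrable lborel u"
  shows "integrable lborel (\<lambda>t. u t * exp (- 2 * \<i> * complex_of_real pi * of_real t * of_real \<xi>))"
proof (rule Bochner_Integration.integrable_bound[OF assms])
  have [measurable]: "u \<in> borel_measurable lborel" using assms by simp
  show "(\<lambda>t. u t * exp (- 2 * \<i> * complex_of_real pi * of_real t * of_real \<xi>)) \<in> borel_measurable lborel"
    by measurable
qed (simp add: norm_mult norm_exp_character)

lemma borel_measurable_fourier_integral:
  assumes "u \<in> borel_measurable borel"
  shows "fourier_integral u \<in> borel_measurable borel"
proof -
  have "(\<lambda>\<xi>. LINT t|lborel. u t * exp (- 2 * \<i> * complex_of_real pi * of_real t * of_real \<xi>))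
      \<in> borel_measurable lborel"
    using assms by measurable
  then show ?thesis by (simp add: fourier_integral_def[abs_def])
qed

lemma cmod_fourier_integral_le:
  "cmod (fourier_integral u \<xi>) \<le> (LINT t|lborel. cmod (u t))"
  unfolding fourier_integral_def
  by (rule order_trans[OF integral_norm_bound]) (simp add: norm_mult norm_exp_character)

text \<open>The multiplication formula. Both sides are iterated integrals of the same kernel over
  the plane; it is absolutely integrable because the character has modulus 1, so Fubini
  applies.\<close>

lemma integral_fourier_integral_mult:
  assumes u: "integrable lborel u" and v: "integrable lborel v"
  shows "(LINT \<xi>|lborel. fourier_integral u \<xi> * v \<xi>) = (LINT t|lborel. u t * fourier_integral v t)"
proof -
  have [measurable]: "u \<in> borel_measurable borel" "v \<in> borel_measurable borel"
    using u v by auto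
  let ?e = "\<lambda>t \<xi>. exp (- 2 * \<i> * complex_of_real pi * of_real t * of_real \<xi>)"
  have "integrable (lborel \<Otimes>\<^sub>M lborel) (\<lambda>(t, \<xi>). u t * v \<xi> * ?e t \<xi>)"
  proof (rule lborel_pair.Fubini_integrable)
    show "integrable lborel (\<lambda>t. LINT \<xi>|lborel. norm (case (t, \<xi>) of (t, \<xi>) \<Rightarrow> u t * v \<xi> * ?e t \<xi>))"
      using u by (simp add: norm_mult norm_exp_character)
    show "AE t in lborel. integrable lborel (\<lambda>\<xi>. case (t, \<xi>) of (t, \<xi>) \<Rightarrow> u t * v \<xi> * ?e t \<xi>)"
      using integrable_character[OF integrable_mult_right[OF v]] by (simp add: mult.commute mult.left_commute)
  qed measurable
  from lborel_pair.Fubini_integral[OF this]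
  show ?thesis
    unfolding fourier_integral_def
    by (simp add: mult.assoc mult.commute mult.left_commute flip: integral_mult_right_zero integral_mult_left_zero)
qed

section \<open>Autocorrelation and its Fourier transform\<close>

text \<open>This is the convolution of \<open>u\<close> with its reflected conjugate. Its value at 0
  is the squared norm of \<open>u\<close>, the quantity that Plancherel's identity has to
  recover.\<close>

definition autocorrelation :: "(real \<Rightarrow> complex) \<Rightarrow> real \<Rightarrow> complex" where
  "autocorrelation u s = (LINT t|lborel. u (t + s) * cnj (u t))"

lemma integrable_translate:
  fixes u :: "real \<Rightarrow> 'a :: {banach, second_countable_topology}"
  assumes "integrable lborel u"
  shows "integrable lborel (\<lambda>t. u (t + s))"
  using lborel_integrable_real_affine[OF assms, of 1 s] by (simp add: add.commute)

lemma integral_translate: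
  fixes u :: "real \<Rightarrow> 'a :: {banach, second_countable_topology}"
  shows "(LINT t|lborel. u (t + s)) = (LINT t|lborel. u t)"
  using lborel_integral_real_affine[of 1 u s] by (simp add: add.commute)

text \<open>The convolution theorem in the case needed. Translation invariance makes the double
  integral absolutely convergent; after Fubini the kernel factors into one part in \<open>t\<close>
  and one in \<open>t + s\<close>.\<close>

lemma
  assumes u: "integrable lborel u"
  shows integrable_autocorrelation: "integrable lborel (autocorrelation u)"
    and fourier_integral_autocorrelation:
      "fourier_integral (autocorrelation u) \<xi> = complex_of_real ((cmod (fourier_integral u \<xi>))\<^sup>2)"
proof -
  let ?e = "\<lambda>t. exp (- 2 * \<i> * complex_of_real pi * of_real t * of_real \<xi>)"
  have [measurable]: "u \<in> borel_measurable borel"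
    using u by auto
  have int_t: "integrable lborel (\<lambda>s. u (t + s))" for t
    using integrable_translate[OF u, of t] by (simp add: add.commute)
  have *: "integrable (lborel \<Otimes>\<^sub>M lborel) (\<lambda>(t, s). u (t + s) * cnj (u t))"
  proof (rule lborel_pair.Fubini_integrable)
    have "(LINT s|lborel. norm (u (t + s) * cnj (u t))) = (LINT s|lborel. cmod (u s)) * cmod (u t)" for t
      using integral_translate[of "\<lambda>s. cmod (u s)" t] by (simp add: norm_mult add.commute)
    then show "integrable lborel (\<lambda>t. LINT s|lborel. norm (case (t, s) of (t, s) \<Rightarrow> u (t + s) * cnj (u t)))"
      using u by simp
    show "AE t in lborel. integrable lborel (\<lambda>s. case (t, s) of (t, s) \<Rightarrow> u (t + s) * cnj (u t))"
      using int_t by simp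
  qed measurable
  from lborel_pair.integrable_snd[OF this] show int: "integrable lborel (autocorrelation u)"
    by (simp add: autocorrelation_def[abs_def])
  have **: "integrable (lborel \<Otimes>\<^sub>M lborel) (\<lambda>(t, s). u (t + s) * cnj (u t) * ?e s)"
    by (rule Bochner_Integration.integrable_bound[OF *])
       (auto simp: norm_mult norm_exp_character split_beta')
  \<comment> \<open>Unimodularity and additivity of the character together give
    \<open>?e s = cnj (?e t) * ?e (t + s)\<close>, which is the factorisation used below.\<close>
  have e_cnj: "cnj (?e t) * ?e t = 1" for t
    using complex_norm_square[of "?e t"] by (simp add: norm_exp_character mult.commute)
  have e_add: "?e (t + s) = ?e t * ?e s" for s t
    by (simp add: ring_distribs flip: exp_add)
  have "fourier_integral (autocorrelation u) \<xi> = (LINT s|lborel. LINT t|lborel. u (t + s) * cnj (u t) * ?e s)"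
    by (simp add: fourier_integral_def autocorrelation_def)
  also have "\<dots> = (LINT t|lborel. LINT s|lborel. u (t + s) * cnj (u t) * ?e s)"
    by (rule lborel_pair.Fubini_integral[OF **])
  also have "\<dots> = (LINT t|lborel. cnj (u t * ?e t) * (LINT s|lborel. u (t + s) * ?e (t + s)))"
  proof (intro Bochner_Integration.integral_cong refl)
    fix t
    have "u (t + s) * cnj (u t) * ?e s = cnj (u t * ?e t) * (u (t + s) * ?e (t + s))" for s
    proof -
      have "cnj (u t * ?e t) * (u (t + s) * ?e (t + s)) = cnj (u t) * u (t + s) * ?e s * (cnj (?e t) * ?e t)"
        unfolding e_add complex_cnj_mult by (simp only: ac_simps)
      then show ?thesis by (simp only: e_cnj) (simp add: ac_simps)
    qed
    then show "(LINT s|lborel. u (t + s) * cnj (u t) * ?e s)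
        = cnj (u t * ?e t) * (LINT s|lborel. u (t + s) * ?e (t + s))"
      by (simp only: integral_mult_right_zero)
  qed
  \<comment> \<open>Translating the inner integral by \<open>t\<close> removes its dependence on
    \<open>t\<close>.\<close>
  also have "\<dots> = (LINT t|lborel. cnj (u t * ?e t) * fourier_integral u \<xi>)"
    unfolding fourier_integral_def
    using integral_translate[of "\<lambda>s. u s * ?e s"] by (simp only: add.commute)
  also have "\<dots> = cnj (fourier_integral u \<xi>) * fourier_integral u \<xi>"
    unfolding fourier_integral_def
    by (simp only: integral_mult_left_zero Bochner_Integration.integral_cnj)
  also have "\<dots> = complex_of_real ((cmod (fourier_integral u \<xi>))\<^sup>2)"
    by (simp only: complex_norm_square mult.commute)
  finally show "fourier_integral (autocorrelation u) \<xi> = complex_of_real ((cmod (fourier_integral u \<xi>))\<^sup>2)" .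
qed

section \<open>Gaussian means of the squared Fourier integral\<close>

lemma integrable_gaussian:
  assumes "k > 0"
  shows "integrable lborel (\<lambda>\<xi>::real. exp (- (\<xi> / k)\<^sup>2 / 2))"
proof -
  have "integrable lborel (\<lambda>x. sqrt (2 * pi) * std_normal_density (0 + (1 / k) * x))"
    using assms by (intro integrable_mult_right lborel_integrable_real_affine integrable_normal_density) auto
  then show ?thesis by (simp add: std_normal_density_def)
qed

text \<open>After scaling by \<open>k\<close> this is the characteristic function of the standard
  normal distribution at \<open>- (2 * pi * k * s)\<close>. The right side is, up to its cast to the
  complex numbers, a probability density in \<open>s\<close> that concentrates at 0 as
  \<open>k\<close> grows: an approximate identity.\<close>

lemma fourier_integral_gaussian:
  assumes "k > 0"
  shows "fourier_integral (\<lambda>\<xi>. of_real (exp (- (\<xi> / k)\<^sup>2 / 2))) s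
    = of_real (2 * pi * k * std_normal_density (2 * pi * k * s))"
proof -
  let ?e = "\<lambda>\<xi>. exp (- 2 * \<i> * complex_of_real pi * of_real \<xi> * of_real s)"
  have "fourier_integral (\<lambda>\<xi>. of_real (exp (- (\<xi> / k)\<^sup>2 / 2))) s
      = k *\<^sub>R (LINT y|lborel. of_real (exp (- y\<^sup>2 / 2)) * ?e (k * y))"
    unfolding fourier_integral_def
    using lborel_integral_real_affine[of k "\<lambda>\<xi>. of_real (exp (- (\<xi> / k)\<^sup>2 / 2)) * ?e \<xi>" 0] assms
    by simp
  also have "(LINT y|lborel. of_real (exp (- y\<^sup>2 / 2)) * ?e (k * y))
      = (LINT y|lborel. of_real (sqrt (2 * pi)) * (std_normal_density y *\<^sub>R iexp ((- (2 * pi * k * s)) * y)))"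
    by (intro Bochner_Integration.integral_cong refl)
       (simp add: std_normal_density_def scaleR_conv_of_real ac_simps)
  also have "\<dots> = of_real (sqrt (2 * pi)) * (LINT y|lborel. std_normal_density y *\<^sub>R iexp ((- (2 * pi * k * s)) * y))"
    by (rule integral_mult_right_zero)
  also have "\<dots> = of_real (sqrt (2 * pi)) * char std_normal_distribution (- (2 * pi * k * s))"
    by (simp add: char_def integral_density)
  also have "\<dots> = of_real (sqrt (2 * pi) * exp (- (2 * pi * k * s)\<^sup>2 / 2))"
    by (simp add: char_std_normal_distribution)
  also have "sqrt (2 * pi) * exp (- (2 * pi * k * s)\<^sup>2 / 2) = 2 * pi * std_normal_density (2 * pi * k * s)"
  proof -
    have "2 * pi * std_normal_density (2 * pi * k * s)
        = (2 * pi / sqrt (2 * pi)) * exp (- (2 * pi * k * s)\<^sup>2 / 2)"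
      by (simp only: std_normal_density_def mult_1_left times_divide_eq_left times_divide_eq_right mult_1_right)
    then show ?thesis by (simp only: real_div_sqrt[of "2 * pi"] pi_ge_zero mult_nonneg_nonneg zero_le_numeral)
  qed
  finally show ?thesis
    by (simp only: scaleR_conv_of_real flip: of_real_mult) (simp only: ac_simps)
qed

text \<open>The multiplication formula is applied to the autocorrelation and a Gaussian.
  Substituting \<open>y = 2 * pi * k * s\<close> then moves \<open>k\<close> out of the weight and
  into the argument of the autocorrelation, so that the limit in \<open>k\<close> can be taken under
  a fixed probability density.\<close>

lemma integral_fourier_gaussian_weight:
  assumes u: "integrable lborel u" and k: "k > 0"
  shows "complex_of_real (LINT \<xi>|lborel. (cmod (fourier_integral u \<xi>))\<^sup>2 * exp (- (\<xi> / k)\<^sup>2 / 2))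
    = (LINT y|lborel. autocorrelation u (y / (2 * pi * k)) * of_real (std_normal_density y))"
proof -
  have "complex_of_real (LINT \<xi>|lborel. (cmod (fourier_integral u \<xi>))\<^sup>2 * exp (- (\<xi> / k)\<^sup>2 / 2))
     = (LINT \<xi>|lborel. fourier_integral (autocorrelation u) \<xi> * of_real (exp (- (\<xi> / k)\<^sup>2 / 2)))"
    unfolding fourier_integral_autocorrelation[OF u] of_real_mult[symmetric]
    by (rule integral_complex_of_real[symmetric])
  also have "\<dots> = (LINT s|lborel. autocorrelation u s
      * fourier_integral (\<lambda>\<xi>. of_real (exp (- (\<xi> / k)\<^sup>2 / 2))) s)"
    by (intro integral_fourier_integral_mult integrable_autocorrelation integrable_of_real
          integrable_gaussian u k)
  also have "\<dots> = (LINT s|lborel. autocorrelation u s * of_real (2 * pi * k * std_normal_density (2 * pi * k * s)))"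
    by (simp only: fourier_integral_gaussian[OF k])
  also have "\<dots> = (1 / (2 * pi * k)) *\<^sub>R (LINT y|lborel. autocorrelation u (y / (2 * pi * k))
      * of_real (2 * pi * k * std_normal_density y))"
    using lborel_integral_real_affine[of "1 / (2 * pi * k)"
        "\<lambda>s. autocorrelation u s * of_real (2 * pi * k * std_normal_density (2 * pi * k * s))" 0] k
    by simp
  also have "\<dots> = (LINT y|lborel. (1 / (2 * pi * k)) *\<^sub>R (autocorrelation u (y / (2 * pi * k))
      * of_real (2 * pi * k * std_normal_density y)))"
    by (rule integral_scaleR_right[symmetric])
  also have "\<dots> = (LINT y|lborel. autocorrelation u (y / (2 * pi * k)) * of_real (std_normal_density y))"
    using k by (intro Bochner_Integration.integral_cong refl) (simp add: scaleR_conv_of_real)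
  finally show ?thesis .
qed

text \<open>The integrand is bounded by the mean of the two squares, and by translation invariance
  both squares have the same integral.\<close>

lemma cmod_autocorrelation_le:
  assumes u: "u \<in> borel_measurable borel" and sq: "integrable lborel (\<lambda>x. (cmod (u x))\<^sup>2)"
  shows "cmod (autocorrelation u s) \<le> (LINT x|lborel. (cmod (u x))\<^sup>2)"
proof -
  have int: "integrable lborel (\<lambda>t. ((cmod (u (t + s)))\<^sup>2 + (cmod (u t))\<^sup>2) / 2)"
    using integrable_translate[OF sq, of s] sq by auto
  have "cmod (autocorrelation u s) \<le> (LINT t|lborel. cmod (u (t + s) * cnj (u t)))"
    unfolding autocorrelation_def by (rule integral_norm_bound)
  also have "\<dots> \<le> (LINT t|lborel. ((cmod (u (t + s)))\<^sup>2 + (cmod (u t))\<^sup>2) / 2)"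
  proof (rule integral_mono')
    show "cmod (u (t + s) * cnj (u t)) \<le> ((cmod (u (t + s)))\<^sup>2 + (cmod (u t))\<^sup>2) / 2" for t
      using sum_squares_bound[of "cmod (u (t + s))" "cmod (u t)"] by (simp add: norm_mult)
  qed (use int in auto)
  also have "\<dots> = (LINT x|lborel. (cmod (u x))\<^sup>2)"
    using integrable_translate[OF sq, of s] sq integral_translate[of "\<lambda>x. (cmod (u x))\<^sup>2" s] by simp
  finally show ?thesis .
qed

lemma integrable_autocorrelation_normal:
  assumes u: "integrable lborel u" and sq: "integrable lborel (\<lambda>x. (cmod (u x))\<^sup>2)"
  shows "integrable lborel (\<lambda>y. autocorrelation u (y / c) * of_real (std_normal_density y))"
proof (rule Bochner_Integration.integrable_bound)
  have [measurable]: "u \<in> borel_measurable borel" using u by auto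
  have [measurable]: "autocorrelation u \<in> borel_measurable borel"
    using integrable_autocorrelation[OF u] by auto
  show "integrable lborel (\<lambda>y. (LINT x|lborel. (cmod (u x))\<^sup>2) * std_normal_density y)"
    by (intro integrable_mult_right integrable_normal_density) auto
  show "(\<lambda>y. autocorrelation u (y / c) * of_real (std_normal_density y)) \<in> borel_measurable lborel"
    by measurable
  have I: "0 \<le> (LINT x|lborel. (cmod (u x))\<^sup>2)" by simp
  show "AE y in lborel. norm (autocorrelation u (y / c) * of_real (std_normal_density y))
      \<le> norm ((LINT x|lborel. (cmod (u x))\<^sup>2) * std_normal_density y)"
  proof (rule AE_I2)
    fix y
    show "norm (autocorrelation u (y / c) * of_real (std_normal_density y))
      \<le> norm ((LINT x|lborel. (cmod (u x))\<^sup>2) * std_normal_density y)"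
      unfolding norm_mult norm_of_real real_norm_def[of "std_normal_density y"]
      using cmod_autocorrelation_le[OF _ sq, of "y / c"] I
      by (intro mult_right_mono) auto
  qed
qed

text \<open>The mean is an average of the autocorrelation against a density of total mass 1, so the
  bound on the autocorrelation carries over. The bound is uniform in \<open>k\<close>, as Fatou's
  lemma will require.\<close>

lemma integral_fourier_gaussian_weight_le:
  assumes u: "integrable lborel u" and sq: "integrable lborel (\<lambda>x. (cmod (u x))\<^sup>2)" and k: "k > 0"
  shows "(LINT \<xi>|lborel. (cmod (fourier_integral u \<xi>))\<^sup>2 * exp (- (\<xi> / k)\<^sup>2 / 2))
    \<le> (LINT x|lborel. (cmod (u x))\<^sup>2)" (is "?L \<le> ?I")
proof -
  have [measurable]: "u \<in> borel_measurable borel" using u by auto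
  have "?L \<le> cmod (complex_of_real ?L)" by simp
  also have "\<dots> \<le> (LINT y|lborel. cmod (autocorrelation u (y / (2 * pi * k)) * of_real (std_normal_density y)))"
    unfolding integral_fourier_gaussian_weight[OF u k] by (rule integral_norm_bound)
  also have "\<dots> \<le> (LINT y|lborel. ?I * std_normal_density y)"
    unfolding norm_mult norm_of_real
    by (intro integral_mono' mult_mono cmod_autocorrelation_le integrable_mult_right sq) (auto)
  also have "\<dots> = ?I" by simp
  finally show ?thesis .
qed

text \<open>The Fourier integral of an integrable function is bounded, so a multiple of the Gaussian
  dominates. This allows the Bochner integrals to be read as nonnegative integrals.\<close>

lemma integrable_fourier_gaussian_weight:
  assumes u: "integrable lborel u" and k: "k > 0"
  shows "integrable lborel (\<lambda>\<xi>. (cmod (fourier_integral u \<xi>))\<^sup>2 * exp (- (\<xi> / k)\<^sup>2 / 2))"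
proof (rule Bochner_Integration.integrable_bound)
  have [measurable]: "fourier_integral u \<in> borel_measurable borel"
    using u by (intro borel_measurable_fourier_integral) auto
  show "integrable lborel (\<lambda>\<xi>::real. (LINT t|lborel. cmod (u t))\<^sup>2 * exp (- (\<xi> / k)\<^sup>2 / 2))"
    by (intro integrable_mult_right integrable_gaussian k)
  show "(\<lambda>\<xi>. (cmod (fourier_integral u \<xi>))\<^sup>2 * exp (- (\<xi> / k)\<^sup>2 / 2)) \<in> borel_measurable lborel"
    by measurable
qed (auto intro!: power_mono cmod_fourier_integral_le)

text \<open>As the Gaussians widen they increase to 1 pointwise. Fatou's lemma with the uniform
  bound on the means gives square-integrability and the inequality half of Plancherel at
  once.\<close>

lemma
  assumes u: "integrable lborel u" and sq: "integrable lborel (\<lambda>x. (cmod (u x))\<^sup>2)"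
  shows integrable_fourier_integral_square: "integrable lborel (\<lambda>\<xi>. (cmod (fourier_integral u \<xi>))\<^sup>2)" (is ?A)
    and integral_fourier_integral_square_le:
      "(LINT \<xi>|lborel. (cmod (fourier_integral u \<xi>))\<^sup>2) \<le> (LINT x|lborel. (cmod (u x))\<^sup>2)" (is "?B \<le> ?I")
proof -
  have [measurable]: "fourier_integral u \<in> borel_measurable borel"
    using u by (intro borel_measurable_fourier_integral) auto
  let ?F = "\<lambda>n \<xi>. (cmod (fourier_integral u \<xi>))\<^sup>2 * exp (- (\<xi> / real (Suc n))\<^sup>2 / 2)"
  have lim: "(\<lambda>n. ?F n \<xi>) \<longlonglongrightarrow> (cmod (fourier_integral u \<xi>))\<^sup>2" for \<xi>
  proof -
    have "(\<lambda>n. \<xi> / real (Suc n)) \<longlonglongrightarrow> 0"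
      by real_asymp
    then have "(\<lambda>n. ?F n \<xi>) \<longlonglongrightarrow> (cmod (fourier_integral u \<xi>))\<^sup>2 * exp (- 0\<^sup>2 / 2)"
      by (intro tendsto_intros) auto
    then show ?thesis by simp
  qed
  have "(\<integral>\<^sup>+\<xi>. ennreal ((cmod (fourier_integral u \<xi>))\<^sup>2) \<partial>lborel)
      = (\<integral>\<^sup>+\<xi>. liminf (\<lambda>n. ennreal (?F n \<xi>)) \<partial>lborel)"
    using lim by (intro nn_integral_cong lim_imp_Liminf[symmetric] tendsto_ennrealI) auto
  also have "\<dots> \<le> liminf (\<lambda>n. \<integral>\<^sup>+\<xi>. ennreal (?F n \<xi>) \<partial>lborel)"
    by (rule nn_integral_liminf) measurable
  also have "\<dots> \<le> limsup (\<lambda>n. \<integral>\<^sup>+\<xi>. ennreal (?F n \<xi>) \<partial>lborel)"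
    by (rule Liminf_le_Limsup) simp
  also have "\<dots> \<le> ennreal ?I"
  proof (rule Limsup_bounded, rule always_eventually, rule allI)
    fix n
    have "(\<integral>\<^sup>+\<xi>. ennreal (?F n \<xi>) \<partial>lborel) = ennreal (LINT \<xi>|lborel. ?F n \<xi>)"
      by (intro nn_integral_eq_integral integrable_fourier_gaussian_weight u) auto
    also have "\<dots> \<le> ennreal ?I"
      by (intro ennreal_leI integral_fourier_gaussian_weight_le u sq) auto
    finally show "(\<integral>\<^sup>+\<xi>. ennreal (?F n \<xi>) \<partial>lborel) \<le> ennreal ?I" .
  qed
  finally have le: "(\<integral>\<^sup>+\<xi>. ennreal ((cmod (fourier_integral u \<xi>))\<^sup>2) \<partial>lborel) \<le> ennreal ?I" .
  show int: ?A
    by (rule integrableI_bounded) (use le in \<open>auto simp: le_less_trans[OF _ ennreal_less_top]\<close>)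
  show "?B \<le> ?I"
    using le by (simp add: nn_integral_eq_integral[OF int] ennreal_le_iff)
qed

section \<open>Continuity of translation and Plancherel's identity\<close>

text \<open>\<open>inner_regular\<close> concerns finite measures, so it is applied to Lebesgue
  measure restricted to \<open>B\<close>, expressed as a density.\<close>

lemma inner_regular_lborel:
  fixes B :: "'a :: euclidean_space set"
  assumes B: "B \<in> sets borel" and fin: "emeasure lborel B < \<infinity>" and e: "(e::real) > 0"
  obtains K where "compact K" "K \<subseteq> B" "emeasure lborel (B - K) < ennreal e"
proof -
  let ?M = "density lborel (indicator B)"
  have em: "emeasure ?M K = emeasure lborel (B \<inter> K)" if "K \<in> sets borel" for K
    using that B by (simp add: emeasure_density nn_integral_set_ennreal flip: indicator_inter_arith)
  have SUP: "emeasure ?M B = (SUP K \<in> {K. K \<subseteq> B \<and> compact K}. emeasure ?M K)"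
    using B fin by (intro inner_regular) (auto simp: em)
  have "\<exists>K \<in> {K. K \<subseteq> B \<and> compact K}. emeasure ?M B < emeasure ?M K + ennreal e"
  proof (rule SUP_approx_ennreal[OF e _ SUP])
    show "{K. K \<subseteq> B \<and> compact K} \<noteq> {}" by (auto intro: exI[of _ "{}"])
    show "emeasure ?M B \<noteq> \<infinity>" using B fin by (simp add: em)
  qed
  then obtain K where K: "K \<subseteq> B" "compact K" "emeasure ?M B < emeasure ?M K + ennreal e"
    by blast
  have K': "K \<in> sets borel" using K by (auto intro: borel_compact)
  have "emeasure lborel B = emeasure lborel K + emeasure lborel (B - K)"
    using K(1) B K' by (subst plus_emeasure) (auto simp: Un_absorb1)
  moreover have "emeasure lborel K < \<infinity>"
    using emeasure_mono[OF K(1), of lborel] fin B by (auto simp: less_top[symmetric] top_unique)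
  moreover have "emeasure lborel B < emeasure lborel K + ennreal e"
    using K B K' by (simp add: em Int_absorb1)
  ultimately have "emeasure lborel (B - K) < ennreal e"
    by (simp add: ennreal_add_left_cancel_less)
  with K show ?thesis using that by blast
qed

text \<open>Take \<open>B\<close> between a compact \<open>K\<close> and an open \<open>U\<close> of
  nearly the same measure. If a shift is shorter than the distance from \<open>K\<close> to the
  complement of \<open>U\<close>, then \<open>x\<close> and \<open>x + s\<close> can be separated by
  \<open>B\<close> only when one of them lies in \<open>U - B\<close> or
  \<open>B - K\<close>.\<close>

lemma tendsto_integral_translate_indicator:
  assumes B: "B \<in> sets borel" and fin: "emeasure lborel B < \<infinity>"
  shows "((\<lambda>s. LINT x|lborel. \<bar>indicator B (x + s) - indicator B x :: real\<bar>) \<longlongrightarrow> 0) (at (0::real))"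
proof (rule tendstoI)
  fix e :: real assume e: "e > 0"
  \<comment> \<open>Four error terms arise, from two thin sets at two points each; a fifth of
    \<open>e\<close> for each leaves strict inequality.\<close>
  then have e5: "e / 5 > 0" by simp
  obtain U where U: "open U" "B \<subseteq> U" "emeasure lborel (U - B) < ennreal (e / 5)"
    using outer_regular_lborel[OF B e5] by blast
  obtain K where K: "compact K" "K \<subseteq> B" "emeasure lborel (B - K) < ennreal (e / 5)"
    using inner_regular_lborel[OF B fin e5] by blast
  obtain d where d: "d > 0" "\<And>x y. x \<in> K \<Longrightarrow> y \<notin> U \<Longrightarrow> d \<le> dist x y"
    using separate_compact_closed[of K "- U"] U K by (force simp: closed_Compl)
  have [measurable]: "U \<in> sets borel" "K \<in> sets borel" "B \<in> sets borel"
    using U K B by (auto intro: borel_compact)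
  let ?i = "\<lambda>A x. indicator A x :: real"
  have bound: "(LINT x|lborel. \<bar>?i B (x + s) - ?i B x\<bar>) < e" if s: "\<bar>s\<bar> < d" for s
  proof -
    have int: "integrable lborel (?i (U - B))" "integrable lborel (?i (B - K))"
      using U K by (auto intro!: integrable_real_indicator elim: order.strict_trans)
    note int' = int[THEN integrable_translate, of s]
    have le: "\<bar>?i B (x + s) - ?i B x\<bar>
        \<le> (?i (U - B) x + ?i (B - K) x) + (?i (U - B) (x + s) + ?i (B - K) (x + s))" for x
      using d(2)[of x "x + s"] d(2)[of "x + s" x] s K(2) U(2)
      by (auto simp: indicator_def dist_real_def)
    have less: "enn2real a < r" if "a < ennreal r" for a r
      using that by (cases a) (auto simp: ennreal_less_iff)
    have meas: "(LINT x|lborel. ?i (U - B) x) < e / 5" "(LINT x|lborel. ?i (B - K) x) < e / 5"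
      using less[OF U(3)] less[OF K(3)] by (simp_all add: measure_def)
    have "(LINT x|lborel. \<bar>?i B (x + s) - ?i B x\<bar>)
        \<le> (LINT x|lborel. (?i (U - B) x + ?i (B - K) x) + (?i (U - B) (x + s) + ?i (B - K) (x + s)))"
      by (intro integral_mono' Bochner_Integration.integrable_add int int' le) auto
    also have "\<dots> = (LINT x|lborel. ?i (U - B) x) + (LINT x|lborel. ?i (B - K) x)
        + ((LINT x|lborel. ?i (U - B) x) + (LINT x|lborel. ?i (B - K) x))"
      using int int' integral_translate[of "?i (U - B)" s] integral_translate[of "?i (B - K)" s]
      by (simp del: integral_indicator Bochner_Integration.integral_indicator)
    also have "\<dots> < e" using meas e by linarith
    finally show ?thesis .
  qed
  show "\<forall>\<^sub>F s in at 0. dist (LINT x|lborel. \<bar>?i B (x + s) - ?i B x\<bar>) 0 < e"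
    unfolding eventually_at using d(1) bound by (intro exI[of _ d]) (auto simp: dist_real_def)
qed

text \<open>Continuity of translation in the L1 norm, carried from indicators through sums to
  dominated limits.\<close>

lemma tendsto_integral_translate:
  fixes u :: "real \<Rightarrow> 'a :: {banach, second_countable_topology}"
  assumes "integrable lborel u"
  shows "((\<lambda>s. LINT x|lborel. norm (u (x + s) - u x)) \<longlongrightarrow> 0) (at 0)"
  using assms
proof (induction u rule: integrable_induct)
  case (base A c)
  have "((\<lambda>s. (LINT x|lborel. \<bar>indicator A (x + s) - indicator A x :: real\<bar>) * norm c) \<longlongrightarrow> 0 * norm c) (at 0)"
    using base by (intro tendsto_intros tendsto_integral_translate_indicator) auto
  then show ?case
    by (simp flip: scaleR_diff_left)
next
  case (add f g)
  show ?case
  proof (rule tendsto_sandwich[OF _ _ tendsto_const])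
    show "((\<lambda>s. (LINT x|lborel. norm (f (x + s) - f x)) + (LINT x|lborel. norm (g (x + s) - g x))) \<longlongrightarrow> 0) (at 0)"
      using tendsto_add[OF add.IH] by simp
    have "(LINT x|lborel. norm ((f (x + s) + g (x + s)) - (f x + g x)))
        \<le> (LINT x|lborel. norm (f (x + s) - f x) + norm (g (x + s) - g x))" for s
      using integrable_translate[OF add.hyps(1), of s] integrable_translate[OF add.hyps(2), of s] add.hyps
      by (intro integral_mono') (auto intro: norm_diff_triangle_ineq)
    also have "\<And>s. \<dots> s = (LINT x|lborel. norm (f (x + s) - f x)) + (LINT x|lborel. norm (g (x + s) - g x))"
      using integrable_translate[OF add.hyps(1)] integrable_translate[OF add.hyps(2)] add.hyps
      by (intro Bochner_Integration.integral_add) auto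
    finally show "\<forall>\<^sub>F s in at 0. (LINT x|lborel. norm ((f (x + s) + g (x + s)) - (f x + g x)))
        \<le> (LINT x|lborel. norm (f (x + s) - f x)) + (LINT x|lborel. norm (g (x + s) - g x))"
      by simp
  qed auto
next
  case (lim f v)
  note [measurable] = borel_measurable_integrable[OF lim.hyps(1)] borel_measurable_integrable[OF lim.hyps(4)]
  have int: "integrable lborel (\<lambda>x. norm (v i x - f x))" for i
    using lim.hyps by auto
  have "(\<lambda>i. LINT x|lborel. norm (v i x - f x)) \<longlonglongrightarrow> (LINT x|(lborel::real measure). 0)"
  proof (rule integral_dominated_convergence)
    \<comment> \<open>The approximants of the induction rule satisfy
      \<open>norm (v i x) \<le> 2 * norm (f x)\<close>; subtracting \<open>f x\<close> adds one
      more.\<close>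
    show "integrable lborel (\<lambda>x. 3 * norm (f x))" using lim.hyps by auto
    show "AE x in lborel. (\<lambda>i. norm (v i x - f x)) \<longlonglongrightarrow> 0"
      using lim.hyps(2) by (auto intro!: tendsto_norm_zero LIM_zero)
    show "AE x in lborel. norm (norm (v i x - f x)) \<le> 3 * norm (f x)" for i
    proof (rule AE_I2)
      fix x show "norm (norm (v i x - f x)) \<le> 3 * norm (f x)"
        using norm_triangle_ineq4[of "v i x" "f x"] lim.hyps(3)[of x i] by simp
    qed
  qed measurable
  then have small: "(\<lambda>i. LINT x|lborel. norm (v i x - f x)) \<longlonglongrightarrow> 0" by simp
  show ?case
  proof (rule tendstoI)
    fix e :: real assume e: "e > 0"
    then obtain i where i: "(LINT x|lborel. norm (v i x - f x)) < e / 3"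
      using order_tendstoD(2)[OF small, of "e / 3"] by (auto simp: eventually_sequentially)
    have "\<forall>\<^sub>F s in at 0. (LINT x|lborel. norm (v i (x + s) - v i x)) < e / 3"
      using order_tendstoD(2)[OF lim.IH[of i], of "e / 3"] e by simp
    then show "\<forall>\<^sub>F s in at 0. dist (LINT x|lborel. norm (f (x + s) - f x)) 0 < e"
    proof eventually_elim
      case (elim s)
      have int': "integrable lborel (\<lambda>x. norm (v i (x + s) - f (x + s)))"
        using integrable_translate[OF int] .
      have int'': "integrable lborel (\<lambda>x. norm (v i (x + s) - v i x))"
        using integrable_translate[OF lim.hyps(1)] lim.hyps(1) by auto
      \<comment> \<open>A three-term estimate through \<open>v i\<close>. By translation invariance
        the first and third terms have the same integral, so one choice of \<open>i\<close> controls
        both for every \<open>s\<close>.\<close>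
      have "(LINT x|lborel. norm (f (x + s) - f x)) \<le> (LINT x|lborel.
          norm (v i (x + s) - f (x + s)) + norm (v i (x + s) - v i x) + norm (v i x - f x))"
      proof (intro integral_mono' Bochner_Integration.integrable_add int int' int'')
        fix x
        have "norm (f (x + s) - f x) = norm (- (v i (x + s) - f (x + s)) + (v i (x + s) - v i x) + (v i x - f x))"
          by simp
        also have "\<dots> \<le> norm (- (v i (x + s) - f (x + s))) + norm (v i (x + s) - v i x) + norm (v i x - f x)"
          by (intro norm_triangle_mono order_refl)
        finally show "norm (f (x + s) - f x)
            \<le> norm (v i (x + s) - f (x + s)) + norm (v i (x + s) - v i x) + norm (v i x - f x)"
          by (simp only: norm_minus_cancel)
      qed auto
      also have "\<dots> = (LINT x|lborel. norm (v i x - f x)) + (LINT x|lborel. norm (v i (x + s) - v i x))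
          + (LINT x|lborel. norm (v i x - f x))"
        using int int' int'' integral_translate[of "\<lambda>x. norm (v i x - f x)" s] by simp
      also have "\<dots> < e" using i elim by linarith
      finally show ?case by simp
    qed
  qed
qed

text \<open>For bounded \<open>u\<close> the increment of the autocorrelation is at most
  \<open>M\<close> times the L1 distance between \<open>u\<close> and its translate, so L1
  continuity of translation suffices.\<close>

lemma tendsto_autocorrelation:
  assumes u: "integrable lborel u" and bdd: "AE x in lborel. cmod (u x) \<le> M"
  shows "(autocorrelation u \<longlongrightarrow> autocorrelation u 0) (at 0)"
proof (rule LIM_zero_cancel, rule tendsto_norm_zero_cancel, rule tendsto_sandwich[OF _ _ tendsto_const])
  show "((\<lambda>s. (LINT x|lborel. norm (u (x + s) - u x)) * M) \<longlongrightarrow> 0) (at 0)"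
    using tendsto_mult_right[OF tendsto_integral_translate[OF u], of M] by simp
  have [measurable]: "u \<in> borel_measurable borel" using u by auto
  have "cmod (autocorrelation u s - autocorrelation u 0) \<le> (LINT x|lborel. norm (u (x + s) - u x)) * M" for s
  proof -
    have int: "integrable lborel (\<lambda>t. u (t + r) * cnj (u t))" for r
    proof (rule Bochner_Integration.integrable_bound)
      show "integrable lborel (\<lambda>t. M * norm (u (t + r)))"
        using integrable_translate[OF u] by auto
      show "AE t in lborel. norm (u (t + r) * cnj (u t)) \<le> norm (M * norm (u (t + r)))"
        using bdd by eventually_elim
          (auto simp: norm_mult mult.commute intro!: mult_right_mono order_trans[OF _ abs_ge_self])
    qed measurable
    have "autocorrelation u s - autocorrelation u 0 = (LINT t|lborel. (u (t + s) - u t) * cnj (u t))"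
      unfolding autocorrelation_def using int[of s] int[of 0]
      by (simp add: left_diff_distrib flip: Bochner_Integration.integral_diff)
    also have "cmod \<dots> \<le> (LINT t|lborel. cmod ((u (t + s) - u t) * cnj (u t)))"
      by (rule integral_norm_bound)
    also have "\<dots> \<le> (LINT t|lborel. cmod (u (t + s) - u t) * M)"
    proof (rule integral_mono_AE)
      show int1: "integrable lborel (\<lambda>t. cmod (u (t + s) - u t) * M)"
        using integrable_translate[OF u] u by auto
      show "AE t in lborel. cmod ((u (t + s) - u t) * cnj (u t)) \<le> cmod (u (t + s) - u t) * M"
        using bdd by eventually_elim (auto simp: norm_mult intro!: mult_left_mono)
      show "integrable lborel (\<lambda>t. cmod ((u (t + s) - u t) * cnj (u t)))"
        using int[of s] int[of 0] by (auto simp: left_diff_distrib)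
    qed
    finally show ?thesis by simp
  qed
  then show "\<forall>\<^sub>F s in at 0. cmod (autocorrelation u s - autocorrelation u 0)
      \<le> (LINT x|lborel. norm (u (x + s) - u x)) * M"
    by simp
qed auto

section \<open>Plancherel's identity for bounded functions\<close>

text \<open>For the missing inequality, the Gaussian means converge to the autocorrelation at 0,
  which is \<open>?I\<close>, while each mean is at most \<open>?B\<close> because its weight is at
  most 1.\<close>

lemma plancherel_bounded:
  assumes u: "integrable lborel u" and sq: "integrable lborel (\<lambda>x. (cmod (u x))\<^sup>2)"
    and bdd: "AE x in lborel. cmod (u x) \<le> M"
  shows "(LINT \<xi>|lborel. (cmod (fourier_integral u \<xi>))\<^sup>2) = (LINT x|lborel. (cmod (u x))\<^sup>2)" (is "?B = ?I")
proof (rule antisym[OF integral_fourier_integral_square_le[OF u sq]])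
  have [measurable]: "u \<in> borel_measurable borel" using u by auto
  have [measurable]: "autocorrelation u \<in> borel_measurable borel"
    using integrable_autocorrelation[OF u] by auto
  let ?G = "\<lambda>n. (LINT \<xi>|lborel. (cmod (fourier_integral u \<xi>))\<^sup>2 * exp (- (\<xi> / real (Suc n))\<^sup>2 / 2))"
  have I: "autocorrelation u 0 = of_real ?I"
    by (simp add: autocorrelation_def complex_norm_square[symmetric] del: of_real_power)
  have "(\<lambda>n. LINT y|lborel. autocorrelation u (y / (2 * pi * real (Suc n))) * of_real (std_normal_density y))
      \<longlonglongrightarrow> (LINT y|lborel. of_real ?I * of_real (std_normal_density y))"
  proof (rule integral_dominated_convergence)
    show "integrable lborel (\<lambda>y. ?I * std_normal_density y)"
      by (intro integrable_mult_right integrable_normal_density) auto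
    show "AE y in lborel. (\<lambda>n. autocorrelation u (y / (2 * pi * real (Suc n))) * of_real (std_normal_density y))
        \<longlonglongrightarrow> of_real ?I * of_real (std_normal_density y)"
    proof (rule AE_I2, rule tendsto_mult[OF _ tendsto_const])
      fix y :: real
      have "isCont (autocorrelation u) 0"
        using tendsto_autocorrelation[OF u bdd] by (simp add: isCont_def)
      moreover have "(\<lambda>n. y / (2 * pi * real (Suc n))) \<longlonglongrightarrow> 0"
        by real_asymp
      ultimately show "(\<lambda>n. autocorrelation u (y / (2 * pi * real (Suc n)))) \<longlonglongrightarrow> of_real ?I"
        unfolding I[symmetric] by (rule isCont_tendsto_compose)
    qed
    show "AE y in lborel. norm (autocorrelation u (y / (2 * pi * real (Suc n))) * of_real (std_normal_density y))
        \<le> ?I * std_normal_density y" for n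
      unfolding norm_mult norm_of_real
      by (intro AE_I2 mult_mono cmod_autocorrelation_le sq) auto
  qed measurable
  also have "(LINT y|lborel. of_real ?I * of_real (std_normal_density y)) = complex_of_real ?I"
    by simp
  finally have "(\<lambda>n. complex_of_real (?G n)) \<longlonglongrightarrow> complex_of_real ?I"
    by (simp only: integral_fourier_gaussian_weight[OF u] of_nat_0_less_iff zero_less_Suc)
  then have "?G \<longlonglongrightarrow> ?I"
    by (simp only: tendsto_of_real_iff)
  then show "?I \<le> ?B"
  proof (rule LIMSEQ_le_const2, intro exI allI impI)
    show "?G n \<le> ?B" for n
      by (intro integral_mono' integrable_fourier_integral_square u sq) (auto simp: mult_left_le)
  qed
qed

section \<open>Riesz bases in \<open>L2\<close>\<close>

lemma square_integrable_L2_fun: "square_integrable (L2_fun f)"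
  using Quotient3_rep_reflp[OF Quotient3_L2, of f] by (simp add: L2_rel_def)

lemma L2_of_L2_fun [simp]: "L2_of (L2_fun f) = f"
  by (rule Quotient3_abs_rep[OF Quotient3_L2])

lemma cinner_L2_of:
  assumes "square_integrable u" "square_integrable v"
  shows "cinner_L2 (L2_of u) (L2_of v) = (LINT x|lborel. u x * cnj (v x))"
  using assms by (intro cinner_L2.abs_eq) (simp_all add: L2_rel_def)

lemma norm_L2_of:
  assumes "square_integrable u"
  shows "(norm (L2_of u))\<^sup>2 = (LINT x|lborel. (cmod (u x))\<^sup>2)"
proof -
  have "(norm (L2_of u))\<^sup>2 = Re (LINT x|lborel. u x * cnj (u x))"
    using cinner_L2_of[OF assms assms] by (simp add: power2_norm_eq_inner inner_L2_def)
  also have "\<dots> = (LINT x|lborel. (cmod (u x))\<^sup>2)"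
    by (simp add: complex_norm_square[symmetric] del: of_real_power)
  finally show ?thesis .
qed

lemma norm_L2_fun: "(norm f)\<^sup>2 = (LINT x|lborel. (cmod (L2_fun f x))\<^sup>2)"
  using norm_L2_of[OF square_integrable_L2_fun[of f]] by simp

lemma square_integrable_diff:
  assumes "square_integrable u" "square_integrable v"
  shows "square_integrable (\<lambda>x. u x - v x)"
  using square_integrable_add[OF assms(1) square_integrable_scale[OF assms(2), of "-1"]] by simp

lemma L2_of_diff:
  assumes "square_integrable u" "square_integrable v"
  shows "L2_of u - L2_of v = L2_of (\<lambda>x. u x - v x)"
proof -
  have "- L2_of v = L2_of (\<lambda>x. - v x)"
    using assms by (intro uminus_L2.abs_eq) (simp add: L2_rel_def)
  moreover have "square_integrable (\<lambda>x. - v x)"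
    using square_integrable_scale[OF assms(2), of "-1"] by simp
  ultimately show ?thesis
    using assms by (simp add: minus_L2_def plus_L2.abs_eq L2_rel_def)
qed

lemma cinner_scaleC_left: "cinner_L2 (c *\<^sub>C f) g = c * cinner_L2 f g"
  by transfer (simp add: mult.assoc)

lemma cinner_scaleC_right: "cinner_L2 f (c *\<^sub>C g) = cnj c * cinner_L2 f g"
proof transfer
  fix c and f g :: "real \<Rightarrow> complex"
  have "(\<lambda>x. f x * cnj (c * g x)) = (\<lambda>x. cnj c * (f x * cnj (g x)))"
    by (simp add: ac_simps)
  then show "(LINT x|lborel. f x * cnj (c * g x)) = cnj c * (LINT x|lborel. f x * cnj (g x))"
    by simp
qed

text \<open>Bessel's inequality by duality. The combination \<open>w\<close> of the
  \<open>f n\<close> is chosen so that its inner product with \<open>v\<close> is the sum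
  \<open>s\<close>, while orthonormality gives \<open>U w\<close> the squared norm \<open>s\<close>.
  Cauchy-Schwarz and the bound on the inverse then leave one factor \<open>norm (U w)\<close> to
  cancel.\<close>

lemma riesz_basis_bessel:
  assumes U: "orthonormalizer U f" and S: "finite S"
  shows "(\<Sum>n\<in>S. (cmod (cinner_L2 (f n) v))\<^sup>2) \<le> (onorm (inv_into UNIV U))\<^sup>2 * (norm v)\<^sup>2"
proof -
  let ?b = "\<lambda>n. cinner_L2 (f n) v" and ?V = "inv_into UNIV U"
  define s where "s = (\<Sum>n\<in>S. (cmod (?b n))\<^sup>2)"
  have lin: "bounded_linear U" "bounded_linear ?V" and hom: "\<And>c g. U (c *\<^sub>C g) = c *\<^sub>C U g"
    and bij: "bij U"
    and orth: "\<And>m n. cinner_L2 (U (f m)) (U (f n)) = (if m = n then 1 else 0)"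
    using U by (auto simp: orthonormalizer_def L2_isomorphism_def orthonormal_basis_def)
  \<comment> \<open>The conjugates turn every term of the inner product of \<open>w\<close> with
    \<open>v\<close> into a squared modulus.\<close>
  define w where "w = (\<Sum>n\<in>S. cnj (?b n) *\<^sub>C f n)"
  have cmod_sq: "(cmod z)\<^sup>2 = Re z * Re z + Im z * Im z" for z
    unfolding cmod_power2 by (simp add: power2_eq_square)
  have "inner w v = (\<Sum>n\<in>S. Re (cnj (?b n) * ?b n))"
    unfolding w_def inner_sum_left by (simp add: inner_L2_def cinner_scaleC_left)
  also have "\<dots> = s"
    by (simp add: s_def cmod_sq)
  finally have "s \<le> norm w * norm v"
    using norm_cauchy_schwarz[of w v] by simp
  have Uw: "U w = (\<Sum>n\<in>S. cnj (?b n) *\<^sub>C U (f n))"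
    by (simp add: w_def linear_sum[OF bounded_linear.linear[OF lin(1)]] hom)
  have orth': "inner (cnj (?b m) *\<^sub>C U (f m)) (cnj (?b n) *\<^sub>C U (f n)) = (if m = n then (cmod (?b m))\<^sup>2 else 0)"
    for m n
    by (simp add: inner_L2_def cinner_scaleC_left cinner_scaleC_right orth cmod_sq)
  have "(norm (U w))\<^sup>2 = inner (U w) (U w)"
    by (rule power2_norm_eq_inner)
  also have "\<dots> = (\<Sum>m\<in>S. \<Sum>n\<in>S. if m = n then (cmod (?b m))\<^sup>2 else 0)"
    unfolding Uw inner_sum_left
    unfolding inner_sum_right orth' ..
  also have "\<dots> = s"
    using S by (simp add: s_def)
  finally have norm_Uw: "(norm (U w))\<^sup>2 = s" .
  have "norm w = norm (?V (U w))"
    using bij by (simp add: bij_def)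
  also have "\<dots> \<le> onorm ?V * norm (U w)"
    by (rule onorm[OF lin(2)])
  finally have "norm w * norm v \<le> onorm ?V * norm (U w) * norm v"
    by (intro mult_right_mono) auto
  with \<open>s \<le> norm w * norm v\<close> have "(norm (U w))\<^sup>2 \<le> (onorm ?V * norm v) * norm (U w)"
    unfolding norm_Uw by (simp add: ac_simps)
  then have "norm (U w) \<le> onorm ?V * norm v"
    using onorm_pos_le[OF lin(2)] by (cases "norm (U w) = 0") (auto simp: power2_eq_square)
  then have "(norm (U w))\<^sup>2 \<le> (onorm ?V * norm v)\<^sup>2"
    by (intro power_mono) auto
  then show ?thesis
    unfolding norm_Uw by (simp add: s_def power_mult_distrib)
qed

text \<open>\<open>U\<close> maps \<open>f n\<close> to a unit vector, so \<open>f n\<close> cannot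
  be short when \<open>U\<close> has small norm.\<close>

lemma riesz_basis_norm_ge:
  assumes U: "orthonormalizer U f"
  shows "1 \<le> (onorm U)\<^sup>2 * (norm (f n))\<^sup>2"
proof -
  have lin: "bounded_linear U" and orth: "cinner_L2 (U (f n)) (U (f n)) = 1"
    using U by (auto simp: orthonormalizer_def L2_isomorphism_def orthonormal_basis_def)
  have "1 = (norm (U (f n)))\<^sup>2"
    by (simp add: power2_norm_eq_inner inner_L2_def orth)
  also have "\<dots> \<le> (onorm U * norm (f n))\<^sup>2"
    by (intro power_mono onorm[OF lin]) auto
  finally show ?thesis by (simp add: power_mult_distrib)
qed

section \<open>The Fourier transform as a contraction of L2\<close>

lemma square_integrable_fourier_integral:
  assumes "integrable lborel u" "square_integrable u"
  shows "square_integrable (fourier_integral u)"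
  using assms integrable_fourier_integral_square[of u] borel_measurable_fourier_integral[of u]
  by (auto simp: square_integrable_def)

lemma norm_L2_of_fourier_integral_le:
  assumes "integrable lborel u" "square_integrable u"
  shows "norm (L2_of (fourier_integral u)) \<le> norm (L2_of u)"
proof (rule power2_le_imp_le)
  show "(norm (L2_of (fourier_integral u)))\<^sup>2 \<le> (norm (L2_of u))\<^sup>2"
    using assms integral_fourier_integral_square_le[of u]
    by (simp add: norm_L2_of[OF square_integrable_fourier_integral[OF assms]] norm_L2_of[OF assms(2)]
        square_integrable_def)
qed simp

text \<open>The contraction estimate for \<open>v - h k\<close> passes to the limit in
  \<open>k\<close>. It gives access to every \<open>g\<close> related to \<open>f\<close> through a
  norm estimate alone.\<close>

lemma norm_L2_of_fourier_integral_diff_le: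
  assumes fg: "has_fourier_transform f g" and v: "integrable lborel v" "square_integrable v"
  shows "norm (L2_of (fourier_integral v) - g) \<le> norm (L2_of v - f)"
proof -
  obtain h where h: "\<And>k. integrable lborel (h k)" "\<And>k. square_integrable (h k)"
      "(\<lambda>k. L2_of (h k)) \<longlonglongrightarrow> f" "(\<lambda>k. L2_of (fourier_integral (h k))) \<longlonglongrightarrow> g"
    using fg unfolding has_fourier_transform_def by blast
  have "norm (L2_of (fourier_integral v) - L2_of (fourier_integral (h k))) \<le> norm (L2_of v - L2_of (h k))" for k
  proof -
    have "fourier_integral (\<lambda>x. v x - h k x) = (\<lambda>\<xi>. fourier_integral v \<xi> - fourier_integral (h k) \<xi>)"
      unfolding fourier_integral_def
      using integrable_character[OF v(1)] integrable_character[OF h(1)[of k]]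
      by (simp add: left_diff_distrib)
    then show ?thesis
      using norm_L2_of_fourier_integral_le[of "\<lambda>x. v x - h k x"] v h(1,2)[of k]
      by (simp add: L2_of_diff square_integrable_fourier_integral square_integrable_diff)
  qed
  then show ?thesis
    by (intro LIMSEQ_le[OF tendsto_norm[OF tendsto_diff[OF tendsto_const h(4)]]
          tendsto_norm[OF tendsto_diff[OF tendsto_const h(3)]]]) auto
qed

text \<open>Dominated convergence, the sets shrinking to the empty set. Cutting by height as well as
  by position makes the remaining part bounded, as \<open>plancherel_bounded\<close>
  demands.\<close>

lemma square_integrable_tail:
  assumes u: "square_integrable u" and e: "e > 0"
  shows "\<exists>R > 0. (LINT x|lborel. indicator {x. R < \<bar>x\<bar> \<or> R < cmod (u x)} x * (cmod (u x))\<^sup>2) < e"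
proof -
  have [measurable]: "u \<in> borel_measurable borel" and int: "integrable lborel (\<lambda>x. (cmod (u x))\<^sup>2)"
    using u by (auto simp: square_integrable_def)
  let ?E = "\<lambda>n::nat. {x. real (Suc n) < \<bar>x\<bar> \<or> real (Suc n) < cmod (u x)}"
  have "(\<lambda>n. LINT x|lborel. indicator (?E n) x * (cmod (u x))\<^sup>2) \<longlonglongrightarrow> (LINT x|(lborel::real measure). 0)"
  proof (rule integral_dominated_convergence[OF _ _ int])
    show "AE x in lborel. (\<lambda>n. indicator (?E n) x * (cmod (u x))\<^sup>2) \<longlonglongrightarrow> 0"
    proof (rule AE_I2, rule tendsto_eventually)
      fix x
      obtain m where m: "max \<bar>x\<bar> (cmod (u x)) \<le> real m"
        using real_arch_simple by blast
      show "\<forall>\<^sub>F n in sequentially. indicator (?E n) x * (cmod (u x))\<^sup>2 = (0::real)"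
        using eventually_ge_at_top[of m] by eventually_elim (use m in \<open>auto simp: indicator_def\<close>)
    qed
  qed (auto simp: indicator_def)
  then have "\<forall>\<^sub>F n in sequentially. (LINT x|lborel. indicator (?E n) x * (cmod (u x))\<^sup>2) < e"
    using e by (auto dest: order_tendstoD(2))
  then obtain n where "(LINT x|lborel. indicator (?E n) x * (cmod (u x))\<^sup>2) < e"
    by (auto simp: eventually_sequentially)
  then show ?thesis by (intro exI[of _ "real (Suc n)"]) auto
qed

section \<open>Orthonormal bases as spherical codes\<close>

text \<open>Working in the type class covers the real and the complex case in one proof; that
  conjugation fixes 1 follows from its being multiplicative and an involution.\<close>

lemma spherical_code_unit_vecs:
  assumes "0 \<in> A"
  shows "spherical_code A d (set (unit_vecs d) :: 'k :: conjugatable_ordered_field vec set)"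
proof -
  have one: "conjugate (1::'k) = 1"
    by (metis conjugate_dist_mul conjugate_id mult.right_neutral mult_1)
  have "unit_vec d i \<bullet>c (unit_vec d j :: 'k vec) = (if i = j then 1 else 0)" if "i < d" "j < d" for i j
    using that one by (simp add: scalar_prod_left_unit)
  then show ?thesis
    using assms by (auto simp: spherical_code_def unit_vecs_def one)
qed

text \<open>Since \<open>d\<close> is free, this places any given natural number below the maximal
  size of some spherical code.\<close>

lemma le_max_spherical_code:
  fixes A :: "'k :: conjugatable_ordered_field set"
  assumes "0 \<in> A"
  shows "enat d \<le> max_spherical_code A d"
proof -
  have "card (set (unit_vecs d) :: 'k vec set) = d"
    by (simp add: unit_vecs_def card_image inj_on_def)
  then show ?thesis
    unfolding max_spherical_code_def
    using SUP_upper[of "set (unit_vecs d)" "{V. spherical_code A d V}" "\<lambda>V. enat (card V)"]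
      spherical_code_unit_vecs[OF assms, of d] by simp
qed

section \<open>Counting the dominated basis elements\<close>

text \<open>By Plancherel \<open>v\<close> loses at most \<open>\<delta>\<close> of the squared norm
  of \<open>f\<close>. Outside the interval its transform has mass at most
  \<open>4 * \<delta>\<close>: twice its squared distance to \<open>g\<close>, plus twice the tail
  of \<open>g\<close>. Together these make up the \<open>5 * \<delta>\<close>.\<close>

lemma fourier_mass_in_interval:
  assumes fg: "has_fourier_transform f g"
    and E[measurable]: "E \<in> sets borel" and fin: "emeasure lborel E < \<infinity>"
    and bdd: "AE x in lborel. x \<in> E \<longrightarrow> cmod (L2_fun f x) \<le> M"
    and f_tail: "(LINT x|lborel. indicator (- E) x * (cmod (L2_fun f x))\<^sup>2) \<le> \<delta>"
    and g_tail: "(LINT \<xi>|lborel. indicator (- {-T..T}) \<xi> * (cmod (L2_fun g \<xi>))\<^sup>2) \<le> \<delta>"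
  defines "v \<equiv> \<lambda>x. indicator E x * L2_fun f x"
  shows "(norm f)\<^sup>2 - 5 * \<delta> \<le> (LINT \<xi>|lborel. indicator {-T..T} \<xi> * (cmod (fourier_integral v \<xi>))\<^sup>2)"
proof -
  let ?f = "L2_fun f" and ?g = "L2_fun g" and ?F = "fourier_integral v" and ?J = "{-T..T}"
  have f: "square_integrable ?f" and g: "square_integrable ?g"
    by (rule square_integrable_L2_fun)+
  then have [measurable]: "?f \<in> borel_measurable borel" "?g \<in> borel_measurable borel"
    and f2: "integrable lborel (\<lambda>x. (cmod (?f x))\<^sup>2)" and g2: "integrable lborel (\<lambda>x. (cmod (?g x))\<^sup>2)"
    by (auto simp: square_integrable_def)
  have cut: "integrable lborel (\<lambda>x. indicator A x * h x)" if "A \<in> sets borel" "integrable lborel h"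
    for A and h :: "real \<Rightarrow> real"
    using integrable_mult_indicator[of A lborel h] that by simp
  have split: "(LINT x|lborel. h x) = (LINT x|lborel. indicator A x * h x) + (LINT x|lborel. indicator (- A) x * h x)"
    if "A \<in> sets borel" "integrable lborel h" for A and h :: "real \<Rightarrow> real"
  proof -
    have "(LINT x|lborel. h x) = (LINT x|lborel. indicator A x * h x + indicator (- A) x * h x)"
      by (intro Bochner_Integration.integral_cong) (auto simp: indicator_def)
    then show ?thesis using cut[OF that] cut[of "- A", OF _ that(2)] that(1) by simp
  qed
  have [measurable]: "v \<in> borel_measurable borel" unfolding v_def by measurable
  have v_sq: "(cmod (v x))\<^sup>2 = indicator E x * (cmod (?f x))\<^sup>2" for x
    by (simp add: v_def indicator_def)
  have v: "square_integrable v"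
    using cut[OF E f2] by (simp add: square_integrable_def v_sq)
  then have v2: "integrable lborel (\<lambda>x. (cmod (v x))\<^sup>2)"
    by (simp add: square_integrable_def)
  \<comment> \<open>The absolute value is needed because no sign is assumed for \<open>M\<close>,
    while \<open>v\<close> vanishes off \<open>E\<close>.\<close>
  have bdd_v: "AE x in lborel. cmod (v x) \<le> \<bar>M\<bar>"
    using bdd by eventually_elim (auto simp: v_def indicator_def)
  have v1: "integrable lborel v"
  proof (rule Bochner_Integration.integrable_bound)
    show "integrable lborel (\<lambda>x. \<bar>M\<bar> * indicator E x)"
      using fin by (intro integrable_mult_right integrable_real_indicator) auto
    show "AE x in lborel. norm (v x) \<le> norm (\<bar>M\<bar> * indicator E x)"
      using bdd by eventually_elim (auto simp: v_def indicator_def)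
  qed measurable
  have F: "square_integrable ?F"
    by (rule square_integrable_fourier_integral[OF v1 v])
  have F2: "integrable lborel (\<lambda>\<xi>. (cmod (?F \<xi>))\<^sup>2)" and [measurable]: "?F \<in> borel_measurable borel"
    using F by (auto simp: square_integrable_def)
  have d2: "integrable lborel (\<lambda>\<xi>. (cmod (?F \<xi> - ?g \<xi>))\<^sup>2)"
    using square_integrable_diff[OF F g] by (simp add: square_integrable_def)
  have "(norm (L2_of v - f))\<^sup>2 = (LINT x|lborel. (cmod (v x - ?f x))\<^sup>2)"
    using norm_L2_of[OF square_integrable_diff[OF v f]] L2_of_diff[OF v f] by simp
  also have "\<dots> = (LINT x|lborel. indicator (- E) x * (cmod (?f x))\<^sup>2)"
    by (intro Bochner_Integration.integral_cong) (auto simp: v_def indicator_def)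
  finally have fv: "(norm (L2_of v - f))\<^sup>2 \<le> \<delta>" using f_tail by simp
  have "(LINT \<xi>|lborel. (cmod (?F \<xi> - ?g \<xi>))\<^sup>2) = (norm (L2_of ?F - g))\<^sup>2"
    using norm_L2_of[OF square_integrable_diff[OF F g]] L2_of_diff[OF F g] by simp
  also have "\<dots> \<le> (norm (L2_of v - f))\<^sup>2"
    by (intro power_mono norm_L2_of_fourier_integral_diff_le fg v1 v) auto
  finally have Fg: "(LINT \<xi>|lborel. (cmod (?F \<xi> - ?g \<xi>))\<^sup>2) \<le> \<delta>" using fv by simp
  have "(LINT \<xi>|lborel. indicator (- ?J) \<xi> * (cmod (?F \<xi>))\<^sup>2)
      \<le> (LINT \<xi>|lborel. 2 * (cmod (?F \<xi> - ?g \<xi>))\<^sup>2 + 2 * (indicator (- ?J) \<xi> * (cmod (?g \<xi>))\<^sup>2))"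
  proof (rule integral_mono')
    show "integrable lborel (\<lambda>\<xi>. 2 * (cmod (?F \<xi> - ?g \<xi>))\<^sup>2 + 2 * (indicator (- ?J) \<xi> * (cmod (?g \<xi>))\<^sup>2))"
      using d2 cut[OF _ g2, of "- ?J"] by auto
    fix \<xi>
    have "(cmod (?F \<xi>))\<^sup>2 \<le> (cmod (?F \<xi> - ?g \<xi>) + cmod (?g \<xi>))\<^sup>2"
      using norm_triangle_ineq[of "?F \<xi> - ?g \<xi>" "?g \<xi>"] by (intro power_mono) auto
    also have "\<dots> \<le> 2 * (cmod (?F \<xi> - ?g \<xi>))\<^sup>2 + 2 * (cmod (?g \<xi>))\<^sup>2"
      using sum_squares_bound[of "cmod (?F \<xi> - ?g \<xi>)" "cmod (?g \<xi>)"] by (simp add: power2_sum)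
    finally show "indicator (- ?J) \<xi> * (cmod (?F \<xi>))\<^sup>2
        \<le> 2 * (cmod (?F \<xi> - ?g \<xi>))\<^sup>2 + 2 * (indicator (- ?J) \<xi> * (cmod (?g \<xi>))\<^sup>2)"
      by (simp add: indicator_def)
  qed auto
  also have "\<dots> = 2 * (LINT \<xi>|lborel. (cmod (?F \<xi> - ?g \<xi>))\<^sup>2)
      + 2 * (LINT \<xi>|lborel. indicator (- ?J) \<xi> * (cmod (?g \<xi>))\<^sup>2)"
    using d2 cut[OF _ g2, of "- ?J"] by simp
  also have "\<dots> \<le> 4 * \<delta>" using Fg g_tail by simp
  finally have "(LINT \<xi>|lborel. indicator (- ?J) \<xi> * (cmod (?F \<xi>))\<^sup>2) \<le> 4 * \<delta>" .
  moreover have "(LINT \<xi>|lborel. (cmod (?F \<xi>))\<^sup>2) = (LINT x|lborel. indicator E x * (cmod (?f x))\<^sup>2)"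
    using plancherel_bounded[OF v1 v2 bdd_v] by (simp add: v_sq)
  ultimately show ?thesis
    using split[OF _ F2, of ?J] split[OF E f2] f_tail norm_L2_fun[of f] by simp
qed

text \<open>The exponent has the opposite sign to the Fourier kernel because the inner product
  conjugates its second argument. Cutting to a set of finite measure puts the character in L2, with
  a norm independent of \<open>\<xi>\<close>.\<close>

lemma cinner_cut_character:
  assumes E[measurable]: "E \<in> sets borel" and fin: "emeasure lborel E < \<infinity>"
  defines "w \<equiv> \<lambda>\<xi>. L2_of (\<lambda>x. indicator E x * exp (2 * \<i> * complex_of_real pi * of_real x * of_real \<xi>))"
  shows "cinner_L2 f (w \<xi>) = fourier_integral (\<lambda>x. indicator E x * L2_fun f x) \<xi>"
    and "(norm (w \<xi>))\<^sup>2 = measure lborel E"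
proof -
  let ?c = "\<lambda>x. indicator E x * exp (2 * \<i> * complex_of_real pi * of_real x * of_real \<xi>)"
  have c2: "(cmod (?c x))\<^sup>2 = indicator E x" for x
    by (simp add: norm_mult norm_exp_eq_Re indicator_def)
  have c: "square_integrable ?c"
    unfolding square_integrable_def c2 using fin by auto
  have "cinner_L2 f (w \<xi>) = (LINT x|lborel. L2_fun f x * cnj (?c x))"
    using cinner_L2_of[OF square_integrable_L2_fun c, of f] by (simp add: w_def)
  also have "\<dots> = fourier_integral (\<lambda>x. indicator E x * L2_fun f x) \<xi>"
    unfolding fourier_integral_def
    by (intro Bochner_Integration.integral_cong) (auto simp: indicator_def exp_cnj)
  finally show "cinner_L2 f (w \<xi>) = fourier_integral (\<lambda>x. indicator E x * L2_fun f x) \<xi>" .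
  show "(norm (w \<xi>))\<^sup>2 = measure lborel E"
    using norm_L2_of[OF c] by (simp add: w_def c2)
qed

lemma integral_indicator_square_mono:
  fixes u :: "real \<Rightarrow> complex"
  assumes u: "square_integrable u" and h: "square_integrable h" and dom: "AE x in lborel. cmod (h x) \<le> cmod (u x)"
    and A[measurable]: "A \<in> sets borel" and B[measurable]: "B \<in> sets borel" and AB: "A \<subseteq> B"
  shows "(LINT x|lborel. indicator A x * (cmod (h x))\<^sup>2) \<le> (LINT x|lborel. indicator B x * (cmod (u x))\<^sup>2)"
proof (rule integral_mono_AE)
  show "integrable lborel (\<lambda>x. indicator A x * (cmod (h x))\<^sup>2)" "integrable lborel (\<lambda>x. indicator B x * (cmod (u x))\<^sup>2)"
    using integrable_mult_indicator[of A lborel "\<lambda>x. (cmod (h x))\<^sup>2"]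
      integrable_mult_indicator[of B lborel "\<lambda>x. (cmod (u x))\<^sup>2"] u h
    by (auto simp: square_integrable_def)
  show "AE x in lborel. indicator A x * (cmod (h x))\<^sup>2 \<le> indicator B x * (cmod (u x))\<^sup>2"
    using dom by eventually_elim (use AB in \<open>auto simp: indicator_def intro!: power_mono\<close>)
qed

text \<open>The constants: each squared norm is at least 1/2, and tails of 1/20 cost 5/20, so each
  term has mass at least 1/4 in the interval. Bessel gives at most \<open>2 * (2 * R)\<close> at
  each frequency, hence \<open>8 * R * T\<close> in total over length \<open>2 * T\<close>, and
  division by 1/4 gives \<open>32 * R * T\<close>.\<close>

lemma riesz_basis_card_dominated_le:
  fixes \<phi> \<psi> :: L2
  assumes \<phi>: "(LINT x|lborel. indicator {x. R < \<bar>x\<bar> \<or> R < cmod (L2_fun \<phi> x)} x * (cmod (L2_fun \<phi> x))\<^sup>2) \<le> 1 / 20"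
    and \<psi>: "(LINT x|lborel. indicator {x. T < \<bar>x\<bar> \<or> T < cmod (L2_fun \<psi> x)} x * (cmod (L2_fun \<psi> x))\<^sup>2) \<le> 1 / 20"
    and R: "R > 0" and T: "T > 0"
    and U: "orthonormalizer U f" "(onorm U)\<^sup>2 \<le> 2" "(onorm (inv_into UNIV U))\<^sup>2 \<le> 2"
    and S: "finite S"
    and dom: "\<And>n. n \<in> S \<Longrightarrow> AE x in lborel. cmod (L2_fun (f n) x) \<le> cmod (L2_fun \<phi> x)"
    and dom': "\<And>n. n \<in> S \<Longrightarrow> \<exists>g. has_fourier_transform (f n) g \<and>
        (AE \<xi> in lborel. cmod (L2_fun g \<xi>) \<le> cmod (L2_fun \<psi> \<xi>))"
  shows "real (card S) \<le> 32 * R * T"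
proof -
  have [measurable]: "L2_fun h \<in> borel_measurable borel" for h
    using square_integrable_L2_fun[of h] by (simp add: square_integrable_def)
  define E where "E = {x. \<bar>x\<bar> \<le> R \<and> cmod (L2_fun \<phi> x) \<le> R}"
  have E[measurable]: "E \<in> sets borel" unfolding E_def by measurable
  have "emeasure lborel E \<le> emeasure lborel {-R..R}"
    by (intro emeasure_mono) (auto simp: E_def)
  also have "\<dots> = ennreal (2 * R)" using R by simp
  finally have em: "emeasure lborel E \<le> ennreal (2 * R)" .
  then have fin: "emeasure lborel E < \<infinity>"
    using ennreal_less_top[of "2 * R"] by (auto simp: le_less_trans)
  have mE: "measure lborel E \<le> 2 * R"
    using em R unfolding measure_def by (intro enn2real_leI) auto
  define q where "q = (\<lambda>n \<xi>. (cmod (fourier_integral (\<lambda>x. indicator E x * L2_fun (f n) x) \<xi>))\<^sup>2)"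
  let ?w = "\<lambda>\<xi>. L2_of (\<lambda>x. indicator E x * exp (2 * \<i> * complex_of_real pi * of_real x * of_real \<xi>))"
  have q_meas[measurable]: "q n \<in> borel_measurable borel" for n
    unfolding q_def by (intro borel_measurable_power borel_measurable_norm
        measurable_compose[OF borel_measurable_fourier_integral borel_measurable_norm] borel_measurable_fourier_integral) measurable
  have q_sum: "(\<Sum>n\<in>S'. q n \<xi>) \<le> 4 * R" if "finite S'" for S' \<xi>
  proof -
    have "(\<Sum>n\<in>S'. q n \<xi>) = (\<Sum>n\<in>S'. (cmod (cinner_L2 (f n) (?w \<xi>)))\<^sup>2)"
      by (simp add: q_def cinner_cut_character(1)[OF E fin])
    also have "\<dots> \<le> (onorm (inv_into UNIV U))\<^sup>2 * (norm (?w \<xi>))\<^sup>2"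
      by (rule riesz_basis_bessel[OF U(1) that])
    also have "\<dots> \<le> 2 * (2 * R)"
      unfolding cinner_cut_character(2)[OF E fin] by (intro mult_mono U(3) mE) auto
    finally show ?thesis by simp
  qed
  have int_J: "integrable lborel (\<lambda>\<xi>. indicator {-T..T} \<xi> * (4 * R))"
    using T by (intro integrable_mult_left integrable_real_indicator) simp_all
  have int_q: "integrable lborel (\<lambda>\<xi>. indicator {-T..T} \<xi> * q n \<xi>)" for n
  proof (rule Bochner_Integration.integrable_bound[OF int_J])
    show "AE \<xi> in lborel. norm (indicator {-T..T} \<xi> * q n \<xi>) \<le> norm (indicator {-T..T} \<xi> * (4 * R))"
      \<comment> \<open>Bessel for a single index bounds \<open>q n\<close> pointwise, which gives
        integrability over the interval.\<close>
      using q_sum[of "{n}"] R by (auto simp: indicator_def q_def)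
  qed measurable
  have lower: "1 / 4 \<le> (LINT \<xi>|lborel. indicator {-T..T} \<xi> * q n \<xi>)" if n: "n \<in> S" for n
  proof -
    obtain g where g: "has_fourier_transform (f n) g" "AE \<xi> in lborel. cmod (L2_fun g \<xi>) \<le> cmod (L2_fun \<psi> \<xi>)"
      using dom'[OF n] by blast
    \<comment> \<open>The complement of \<open>E\<close> is exactly the tail set of
      \<open>\<phi>\<close>.\<close>
    have "(LINT x|lborel. indicator (- E) x * (cmod (L2_fun (f n) x))\<^sup>2) \<le> 1 / 20"
      by (rule order_trans[OF integral_indicator_square_mono \<phi>])
         (auto intro!: square_integrable_L2_fun dom n simp: E_def)
    \<comment> \<open>The complement of the interval is only part of the tail set of
      \<open>\<psi>\<close>, which also cuts by height; monotonicity covers the difference.\<close>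
    moreover have "(LINT \<xi>|lborel. indicator (- {-T..T}) \<xi> * (cmod (L2_fun g \<xi>))\<^sup>2) \<le> 1 / 20"
      by (rule order_trans[OF integral_indicator_square_mono \<psi>])
         (auto intro!: square_integrable_L2_fun g(2))
    moreover have "AE x in lborel. x \<in> E \<longrightarrow> cmod (L2_fun (f n) x) \<le> R"
      using dom[OF n] by eventually_elim (auto simp: E_def)
    ultimately have "(norm (f n))\<^sup>2 - 5 * (1 / 20) \<le> (LINT \<xi>|lborel. indicator {-T..T} \<xi> * q n \<xi>)"
      unfolding q_def by (intro fourier_mass_in_interval[OF g(1) E fin])
    moreover have "1 \<le> 2 * (norm (f n))\<^sup>2"
      using riesz_basis_norm_ge[OF U(1), of n] mult_right_mono[OF U(2), of "(norm (f n))\<^sup>2"] by simp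
    ultimately show ?thesis by simp
  qed
  have "real (card S) * (1 / 4) \<le> (\<Sum>n\<in>S. LINT \<xi>|lborel. indicator {-T..T} \<xi> * q n \<xi>)"
    using sum_mono[OF lower, of S "\<lambda>n. n"] by simp
  also have "\<dots> = (LINT \<xi>|lborel. indicator {-T..T} \<xi> * (\<Sum>n\<in>S. q n \<xi>))"
    using int_q by (simp add: sum_distrib_left)
  also have "\<dots> \<le> (LINT \<xi>|lborel. indicator {-T..T} \<xi> * (4 * R))"
    using R by (intro integral_mono' int_J mult_left_mono q_sum S) auto
  also have "\<dots> = 8 * R * T"
    using T by simp
  finally show ?thesis by simp
qed

theorem theorem3p13:
  shows "\<exists>\<beta>\<^sub>0 > 0. \<forall>\<beta> :: real. 0 \<le> \<beta> \<and> \<beta> \<le> \<beta>\<^sub>0 \<longrightarrow>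
    (\<forall>\<phi> \<psi> :: L2. norm \<phi> \<ge> 1 \<and> norm \<psi> \<ge> 1 \<longrightarrow>
      (\<exists>N :: nat.
         (\<forall>f U. riesz_basis f \<and> orthonormalizer U f
            \<and> inverse (1 + \<beta>) \<le> (onorm U)\<^sup>2
            \<and> (onorm U)\<^sup>2 \<le> (onorm (inv_into UNIV U))\<^sup>2
            \<and> (onorm (inv_into UNIV U))\<^sup>2 \<le> 1 + \<beta> \<longrightarrow>
            (let S = {n. (AE x in lborel. cmod (L2_fun (f n) x) \<le> cmod (L2_fun \<phi> x)) \<and>
                         (\<exists>g. has_fourier_transform (f n) g \<and>
                              (AE \<xi> in lborel. cmod (L2_fun g \<xi>) \<le> cmod (L2_fun \<psi> \<xi>)))}
             in finite S \<and> card S \<le> N))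
         \<and> (\<exists>(\<alpha> :: real) (d :: nat). 0 \<le> \<alpha> \<and> \<alpha> < 1 \<and> 1 \<le> d \<and>
              enat N \<le> max_spherical_code {z :: complex. cmod z \<le> \<alpha>} d)
         \<and> (\<exists>(\<alpha> :: real) (d :: nat). 0 \<le> \<alpha> \<and> \<alpha> < 1 \<and> 1 \<le> d \<and>
              enat N \<le> max_spherical_code {-\<alpha>..\<alpha>} d)))"
\<comment> \<open>With \<open>\<beta>\<close> at most 1, both squared operator norms are at most
  \<open>1 + \<beta> \<le> 2\<close>, the bound that the counting lemma uses.\<close>
proof (rule exI[of _ 1], intro conjI allI impI)
  fix \<beta> :: real and \<phi> \<psi> :: L2
  assume \<beta>: "0 \<le> \<beta> \<and> \<beta> \<le> 1"
  obtain R where R: "R > 0"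
      "(LINT x|lborel. indicator {x. R < \<bar>x\<bar> \<or> R < cmod (L2_fun \<phi> x)} x * (cmod (L2_fun \<phi> x))\<^sup>2) < 1 / 20"
    using square_integrable_tail[OF square_integrable_L2_fun[of \<phi>], of "1 / 20"] by auto
  obtain T where T: "T > 0"
      "(LINT x|lborel. indicator {x. T < \<bar>x\<bar> \<or> T < cmod (L2_fun \<psi> x)} x * (cmod (L2_fun \<psi> x))\<^sup>2) < 1 / 20"
    using square_integrable_tail[OF square_integrable_L2_fun[of \<psi>], of "1 / 20"] by auto
  \<comment> \<open>\<open>R\<close> and \<open>T\<close> come from \<open>\<phi>\<close> and
    \<open>\<psi>\<close> alone, so \<open>N\<close> is fixed before the basis and its
    orthonormalizer.\<close>
  define N where "N = nat \<lceil>32 * R * T\<rceil>"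
  show "\<exists>N :: nat.
         (\<forall>f U. riesz_basis f \<and> orthonormalizer U f
            \<and> inverse (1 + \<beta>) \<le> (onorm U)\<^sup>2
            \<and> (onorm U)\<^sup>2 \<le> (onorm (inv_into UNIV U))\<^sup>2
            \<and> (onorm (inv_into UNIV U))\<^sup>2 \<le> 1 + \<beta> \<longrightarrow>
            (let S = {n. (AE x in lborel. cmod (L2_fun (f n) x) \<le> cmod (L2_fun \<phi> x)) \<and>
                         (\<exists>g. has_fourier_transform (f n) g \<and>
                              (AE \<xi> in lborel. cmod (L2_fun g \<xi>) \<le> cmod (L2_fun \<psi> \<xi>)))}
             in finite S \<and> card S \<le> N))
         \<and> (\<exists>(\<alpha> :: real) (d :: nat). 0 \<le> \<alpha> \<and> \<alpha> < 1 \<and> 1 \<le> d \<and>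
              enat N \<le> max_spherical_code {z :: complex. cmod z \<le> \<alpha>} d)
         \<and> (\<exists>(\<alpha> :: real) (d :: nat). 0 \<le> \<alpha> \<and> \<alpha> < 1 \<and> 1 \<le> d \<and>
              enat N \<le> max_spherical_code {-\<alpha>..\<alpha>} d)"
  proof (rule exI[of _ N], intro conjI allI impI)
    fix f U
    assume U: "riesz_basis f \<and> orthonormalizer U f
            \<and> inverse (1 + \<beta>) \<le> (onorm U)\<^sup>2
            \<and> (onorm U)\<^sup>2 \<le> (onorm (inv_into UNIV U))\<^sup>2
            \<and> (onorm (inv_into UNIV U))\<^sup>2 \<le> 1 + \<beta>"
    define S where "S = {n. (AE x in lborel. cmod (L2_fun (f n) x) \<le> cmod (L2_fun \<phi> x)) \<and>
                         (\<exists>g. has_fourier_transform (f n) g \<and>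
                              (AE \<xi> in lborel. cmod (L2_fun g \<xi>) \<le> cmod (L2_fun \<psi> \<xi>)))}"
    have "finite S \<and> card S \<le> N"
    \<comment> \<open>Bessel's inequality is available for finite index sets; a bound uniform over
      the finite subsets of \<open>S\<close> also yields that \<open>S\<close> is finite.\<close>
    proof (rule finite_if_finite_subsets_card_bdd)
      fix G assume G: "G \<subseteq> S" "finite G"
      have "real (card G) \<le> 32 * R * T"
      proof (rule riesz_basis_card_dominated_le[of R \<phi> T \<psi> U f])
        show "AE x in lborel. cmod (L2_fun (f n) x) \<le> cmod (L2_fun \<phi> x)"
          "\<exists>g. has_fourier_transform (f n) g \<and> (AE \<xi> in lborel. cmod (L2_fun g \<xi>) \<le> cmod (L2_fun \<psi> \<xi>))"
          if "n \<in> G" for n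
          using that G(1) by (auto simp: S_def)
      qed (use R T U \<beta> G in auto)
      then show "card G \<le> N"
        unfolding N_def by linarith
    qed
    then show "let S = {n. (AE x in lborel. cmod (L2_fun (f n) x) \<le> cmod (L2_fun \<phi> x)) \<and>
                         (\<exists>g. has_fourier_transform (f n) g \<and>
                              (AE \<xi> in lborel. cmod (L2_fun g \<xi>) \<le> cmod (L2_fun \<psi> \<xi>)))}
             in finite S \<and> card S \<le> N"
      by (simp add: S_def)
  next
    show "\<exists>(\<alpha> :: real) (d :: nat). 0 \<le> \<alpha> \<and> \<alpha> < 1 \<and> 1 \<le> d \<and>
        enat N \<le> max_spherical_code {z :: complex. cmod z \<le> \<alpha>} d"
      \<comment> \<open>Orthogonality allows \<alpha> = 0, and dimension \<open>max 1 N\<close>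
        meets \<open>1 \<le> d\<close> without inspecting \<open>N\<close>.\<close>
      using order_trans[OF _ le_max_spherical_code[of "{z :: complex. cmod z \<le> 0}" "max 1 N"], of "enat N"]
      by (intro exI[of _ 0] exI[of _ "max 1 N"]) simp
    show "\<exists>(\<alpha> :: real) (d :: nat). 0 \<le> \<alpha> \<and> \<alpha> < 1 \<and> 1 \<le> d \<and>
        enat N \<le> max_spherical_code {-\<alpha>..\<alpha>} d"
      using order_trans[OF _ le_max_spherical_code[of "{- 0..0 :: real}" "max 1 N"], of "enat N"]
      by (intro exI[of _ 0] exI[of _ "max 1 N"]) simp
  qed
qed simp

end
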